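(* Let $n\ge 1$, let $f:\mathbb{R}^n\to\mathbb{R}$ be a smooth convex function and let $M\subset\mathbb{E}^{n+1}$ be its graph. For $p=(x,f(x))\in M$ put $W(p)=\sqrt{1+|\nabla f(x)|^2}$. For $k>0$, let $\Psi$ be the tangent hyperplane of $M$ at $p$, let $\Phi$ be the hyperplane through $(x,f(x)+k)$ parallel to $\Psi$, and let $S_p^*(k)$ denote the $n$-dimensional surface area of the part of $M$ lying between the hyperplanes $\Phi$ and $\Psi$. Then $M$ does not satisfy the following condition $(S^* )$: there is a nonnegative function $\eta$ of $k$ alone such that $S_p^*(k)/W(p)=\eta(k)$ for all $p\in M$ and all $k>0$.
   Context: $\nabla f$ denotes the gradient of $f$. *)

theory Defs
  imports "HOL-Analysis.Analysis"
begin

text \<open>Smoothness (C-infinity) of a function on R^n: all partial derivatives of all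
  orders exist everywhere and are continuous. Equivalently: there is a family of
  continuous functions containing f and closed under taking partial derivatives.\<close>
definition smooth_fun :: "(real ^ 'n \<Rightarrow> real) \<Rightarrow> bool" where
  "smooth_fun f \<longleftrightarrow>
     (\<exists>S. f \<in> S \<and> (\<forall>g\<in>S. continuous_on UNIV g) \<and>
        (\<forall>g\<in>S. \<forall>i. \<exists>h\<in>S. \<forall>x.
            ((\<lambda>t. g (x + t *\<^sub>R axis i 1)) has_real_derivative h x) (at 0)))"

definition grad :: "(real ^ 'n \<Rightarrow> real) \<Rightarrow> real ^ 'n \<Rightarrow> real ^ 'n" where
  "grad f x = (THE D. (f has_derivative (\<lambda>h. D \<bullet> h)) (at x))"

definition Wfun :: "(real ^ 'n \<Rightarrow> real) \<Rightarrow> real ^ 'n \<Rightarrow> real" where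
  "Wfun f x = sqrt (1 + (norm (grad f x))\<^sup>2)"

text \<open>Parameters y of the points (y, f y) of the graph lying between the tangent
  hyperplane Psi at (x, f x) and the parallel hyperplane Phi through (x, f x + k).\<close>
definition slab_region :: "(real ^ 'n \<Rightarrow> real) \<Rightarrow> real ^ 'n \<Rightarrow> real \<Rightarrow> (real ^ 'n) set" where
  "slab_region f x k =
     {y. f x + grad f x \<bullet> (y - x) \<le> f y \<and> f y \<le> f x + grad f x \<bullet> (y - x) + k}"

text \<open>n-dimensional surface area of that part of the graph (area formula for graphs),
  possibly infinite.\<close>
definition S_star :: "(real ^ 'n \<Rightarrow> real) \<Rightarrow> real ^ 'n \<Rightarrow> real \<Rightarrow> ennreal" where
  "S_star f x k = (\<integral>\<^sup>+ y. ennreal (Wfun f y) * indicator (slab_region f x k) y \<partial>lborel)"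

end

theory Submission
  imports Defs
begin

text \<open>
  Subtract from \<open>f\<close> its tangent plane at the origin, giving \<open>F \<ge> 0 = F 0\<close>, and let \<open>R(x,k)\<close> be the
  projection of the part of the graph cut off at \<open>x\<close>. Since \<open>R(0,1)\<close> has finite volume, it is
  bounded, so \<open>F\<close> grows at least linearly. Integrating the partial derivatives of \<open>F\<close> along
  parallel lines, on each of which their absolute integral over \<open>{F \<le> k}\<close> is at most \<open>2 k\<close>, shows
  that \<open>\<eta> k = O(k ^ n)\<close>.

  If \<open>F\<close> is superlinear, choose \<open>x\<close> with \<open>W x > W 0\<close>. For every \<open>r > 1\<close> and all large \<open>k\<close> one has
  \<open>R(x,k) \<subseteq> R(0,r k)\<close>, hence \<open>(W x / W 0) * \<eta> k \<le> \<eta> (r k)\<close>, and \<open>\<eta>\<close> outgrows every power of \<open>k\<close>.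

  Otherwise let \<open>\<theta>\<close> be the largest slope of linear lower bounds and \<open>v\<close> a unit vector along which \<open>F\<close>
  grows with slope at most \<open>\<theta>\<close>. There are points with gradient \<open>(1 - \<delta>)\<theta> v\<close> at which, for large \<open>k\<close>,
  the section contains a cylinder over \<open>{F \<le> k / 24}\<close> of length \<open>k / (8 \<delta> \<theta>)\<close> in the direction \<open>v\<close>.
  Its area is therefore an arbitrarily large multiple of the area at \<open>0\<close> as \<open>\<delta>\<close> tends to \<open>0\<close>, while \<open>W\<close>
  stays bounded at these points.
\<close>

section \<open>Translates, line averages and one-dimensional bounds\<close>

lemma nn_integral_lborel_translate:
  fixes g :: "'a::euclidean_space \<Rightarrow> ennreal"
  assumes "g \<in> borel_measurable borel"
  shows "(\<integral>\<^sup>+ y. g (y + c) \<partial>lborel) = (\<integral>\<^sup>+ y. g y \<partial>lborel)"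
proof -
  have "(\<integral>\<^sup>+ y. g y \<partial>lborel) = (\<integral>\<^sup>+ y. g y \<partial>distr lborel borel ((+) c))"
    by (simp add: lborel_distr_plus)
  also have "\<dots> = (\<integral>\<^sup>+ y. g (c + y) \<partial>lborel)"
    using assms by (intro nn_integral_distr) auto
  finally show ?thesis by (simp add: add.commute)
qed

lemma emeasure_lborel_translate:
  fixes A :: "'a::euclidean_space set"
  assumes "A \<in> sets borel"
  shows "emeasure lborel ((\<lambda>y. y + c) ` A) = emeasure lborel A"
proof -
  have eq: "(\<lambda>y. y + c) ` A = (\<lambda>y. y + (- c)) -` A"
  proof (intro set_eqI iffI)
    fix x assume "x \<in> (\<lambda>y. y + (- c)) -` A"
    then show "x \<in> (\<lambda>y. y + c) ` A" by (intro image_eqI[of _ _ "x + (- c)"]) auto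
  qed auto
  have m: "(\<lambda>y. y + c) ` A \<in> sets borel"
    unfolding eq using measurable_sets[of "\<lambda>y. y + (- c)" borel borel A] assms by auto
  have "emeasure lborel ((\<lambda>y. y + c) ` A) = (\<integral>\<^sup>+ y. indicator ((\<lambda>y. y + c) ` A) y \<partial>lborel)"
    using m by simp
  also have "\<dots> = (\<integral>\<^sup>+ y. indicator ((\<lambda>y. y + c) ` A) (y + c) \<partial>lborel)"
    using m by (intro nn_integral_lborel_translate[symmetric]) auto
  also have "\<dots> = (\<integral>\<^sup>+ y. indicator A y \<partial>lborel)"
    by (intro nn_integral_cong) (auto simp: indicator_def)
  finally show ?thesis using assms by simp
qed

lemma emeasure_lborel_scaleR:
  fixes A :: "'a::euclidean_space set"
  assumes "A \<in> sets borel" "c > 0"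
  shows "emeasure lborel ((*\<^sub>R) c ` A) = ennreal (c ^ DIM('a)) * emeasure lborel A"
proof -
  have eq: "(*\<^sub>R) c ` A = (*\<^sub>R) (1/c) -` A"
  proof (intro set_eqI iffI)
    fix x assume "x \<in> (*\<^sub>R) (1/c) -` A"
    then show "x \<in> (*\<^sub>R) c ` A" using assms(2) by (intro image_eqI[of _ _ "(1/c) *\<^sub>R x"]) auto
  qed (use assms(2) in auto)
  have m: "(*\<^sub>R) c ` A \<in> sets borel"
    unfolding eq using measurable_sets[of "(*\<^sub>R) (1/c)" borel borel A] assms by auto
  have "emeasure lborel ((*\<^sub>R) c ` A) =
      emeasure (density (distr lborel borel (\<lambda>x. 0 + c *\<^sub>R x)) (\<lambda>_. \<bar>c\<bar>^DIM('a))) ((*\<^sub>R) c ` A)"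
    using assms(2) by (subst lborel_affine[of c 0]) auto
  also have "\<dots> = ennreal (c ^ DIM('a)) * emeasure (distr lborel borel (\<lambda>x. 0 + c *\<^sub>R x)) ((*\<^sub>R) c ` A)"
    using m assms(2) by (subst emeasure_density) (auto simp: nn_integral_cmult)
  also have "emeasure (distr lborel borel (\<lambda>x. 0 + c *\<^sub>R x)) ((*\<^sub>R) c ` A)
     = emeasure lborel ((\<lambda>x. 0 + c *\<^sub>R x) -` ((*\<^sub>R) c ` A) \<inter> space lborel)"
    using m by (intro emeasure_distr) auto
  also have "(\<lambda>x. 0 + c *\<^sub>R x) -` ((*\<^sub>R) c ` A) \<inter> space lborel = A"
    using assms(2) by auto
  finally show ?thesis .
qed

text \<open>Condition \<open>width\<close> keeps the extent of \<open>B\<close> in the functional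
  \<open>l\<close> below one shift \<open>l \<bullet> w\<close>, so the translates are pairwise
  disjoint and their volumes add up inside \<open>Q\<close>. This converts lengths into multiples of
  volume.\<close>

lemma emeasure_disjoint_translates_le:
  fixes B Q :: "'a::euclidean_space set"
  assumes [measurable]: "B \<in> sets borel" "Q \<in> sets borel"
    and width: "\<And>y z. y \<in> B \<Longrightarrow> z \<in> B \<Longrightarrow> l \<bullet> (y - z) < l \<bullet> w"
    and sub: "\<And>y j. y \<in> B \<Longrightarrow> j < N \<Longrightarrow> y + (c + real j *\<^sub>R w) \<in> Q"
  shows "of_nat N * emeasure lborel B \<le> emeasure lborel Q"
proof -
  define B' where "B' j = (\<lambda>y. y + (c + real j *\<^sub>R w)) ` B" for j
  have B'eq: "B' j = (\<lambda>y. y + (- (c + real j *\<^sub>R w))) -` B" for j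
    unfolding B'_def
  proof (intro set_eqI iffI)
    fix x assume "x \<in> (\<lambda>y. y + (- (c + real j *\<^sub>R w))) -` B"
    then show "x \<in> (\<lambda>y. y + (c + real j *\<^sub>R w)) ` B"
      by (intro image_eqI[of _ _ "x + (- (c + real j *\<^sub>R w))"]) auto
  qed auto
  have B'm: "B' j \<in> sets borel" for j
    unfolding B'eq using measurable_sets[of "\<lambda>y. y + (- (c + real j *\<^sub>R w))" borel borel B] by auto
  have disj: "B' i \<inter> B' j = {}" if "i < j" for i j
  proof (rule ccontr)
    assume "B' i \<inter> B' j \<noteq> {}"
    then obtain y z where yz: "y \<in> B" "z \<in> B" "y + (c + real i *\<^sub>R w) = z + (c + real j *\<^sub>R w)"
      unfolding B'_def by auto
    then have e: "y - z = (real j - real i) *\<^sub>R w" by (simp add: algebra_simps)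
    have pos: "l \<bullet> w > 0" using width[OF yz(1) yz(1)] by simp
    have "l \<bullet> (y - z) = (real j - real i) * (l \<bullet> w)" using e by simp
    moreover have "(real j - real i) * (l \<bullet> w) \<ge> 1 * (l \<bullet> w)"
      using that pos by (intro mult_right_mono) auto
    ultimately show False using width[OF yz(1,2)] by linarith
  qed
  have df: "disjoint_family_on B' {..<N}"
    unfolding disjoint_family_on_def
    by (metis disj inf_commute linorder_neqE_nat)
  have "of_nat N * emeasure lborel B = (\<Sum>j<N. emeasure lborel (B' j))"
    unfolding B'_def by (simp add: emeasure_lborel_translate)
  also have "\<dots> = emeasure lborel (\<Union>j<N. B' j)"
    using df B'm by (intro sum_emeasure) auto
  also have "\<dots> \<le> emeasure lborel Q"
    using sub by (intro emeasure_mono) (auto simp: B'_def)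
  finally show ?thesis .
qed

text \<open>Fubini and translation invariance: every \<open>t\<close> in the interval contributes
  the same integral. One-dimensional estimates along lines parallel to \<open>b\<close> thus
  integrate over the whole space without splitting off a hyperplane.\<close>

lemma nn_integral_lborel_line_average:
  fixes g :: "'a::euclidean_space \<Rightarrow> ennreal"
  assumes [measurable]: "g \<in> borel_measurable borel" and "T \<ge> 0"
  shows "ennreal T * (\<integral>\<^sup>+ y. g y \<partial>lborel)
     = (\<integral>\<^sup>+ y. (\<integral>\<^sup>+ t. g (y + t *\<^sub>R b) * indicator {0..T} t \<partial>lborel) \<partial>lborel)"
proof -
  have "(\<integral>\<^sup>+ y. (\<integral>\<^sup>+ t. g (y + t *\<^sub>R b) * indicator {0..T} t \<partial>lborel) \<partial>lborel)
      = (\<integral>\<^sup>+ t. (\<integral>\<^sup>+ y. g (y + t *\<^sub>R b) * indicator {0..T} t \<partial>lborel) \<partial>lborel)"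
    by (rule lborel_pair.Fubini') (simp add: split_beta')
  also have "\<dots> = (\<integral>\<^sup>+ t. (\<integral>\<^sup>+ y. g y \<partial>lborel) * indicator {0..T} t \<partial>lborel)"
    by (intro nn_integral_cong) (simp add: nn_integral_multc nn_integral_lborel_translate)
  also have "\<dots> = ennreal T * (\<integral>\<^sup>+ y. g y \<partial>lborel)"
    using assms(2) by (simp add: nn_integral_cmult mult.commute)
  finally show ?thesis by simp
qed

lemma convex_on_ge_tangent:
  fixes F :: "'a::real_inner \<Rightarrow> real"
  assumes "convex_on UNIV F" "(F has_derivative (\<lambda>h. g \<bullet> h)) (at x)"
  shows "F y \<ge> F x + g \<bullet> (y - x)"
proof -
  define \<phi> where "\<phi> t = F (x + t *\<^sub>R (y - x))" for t :: real
  have "(\<phi> has_derivative (\<lambda>h. g \<bullet> (h *\<^sub>R (y - x)))) (at 0)"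
    unfolding \<phi>_def
    by (rule has_derivative_compose[where f="\<lambda>t. x + t *\<^sub>R (y - x)"]) (auto intro!: derivative_eq_intros assms(2))
  then have "(\<phi> has_real_derivative (g \<bullet> (y - x))) (at 0)"
    by (simp add: has_field_derivative_def mult_commute_abs)
  then have lim: "((\<lambda>t. (\<phi> t - \<phi> 0) / t) \<longlongrightarrow> g \<bullet> (y - x)) (at_right 0)"
    by (auto simp: has_field_derivative_iff intro: filterlim_mono[OF _ _ at_le])
  have "eventually (\<lambda>t. (\<phi> t - \<phi> 0) / t \<le> F y - F x) (at_right 0)"
  proof -
    have "(\<phi> t - \<phi> 0) / t \<le> F y - F x" if "t > 0" "t < 1" for t
    proof -
      have "F ((1 - t) *\<^sub>R x + t *\<^sub>R y) \<le> (1 - t) * F x + t * F y"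
        using convex_onD[OF assms(1), of t x y] that by auto
      moreover have "(1 - t) *\<^sub>R x + t *\<^sub>R y = x + t *\<^sub>R (y - x)" by (simp add: algebra_simps)
      ultimately have "\<phi> t - \<phi> 0 \<le> t * (F y - F x)" by (simp add: \<phi>_def algebra_simps)
      then show ?thesis using that by (simp add: divide_le_eq mult.commute)
    qed
    then show ?thesis by (auto simp: eventually_at_right[of 0 1] intro!: exI[of _ 1])
  qed
  then have "g \<bullet> (y - x) \<le> F y - F x"
    by (intro tendsto_upperbound[OF lim]) auto
  then show ?thesis by simp
qed

lemma convex_sublevel:
  fixes F :: "'a::real_vector \<Rightarrow> real"
  assumes "convex_on UNIV F"
  shows "convex {y. F y \<le> k}"
proof (rule convexI)
  fix x y :: 'a and u v :: real
  assume *: "x \<in> {y. F y \<le> k}" "y \<in> {y. F y \<le> k}" "0 \<le> u" "0 \<le> v" "u + v = 1"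
  have "F (u *\<^sub>R x + v *\<^sub>R y) \<le> u * F x + v * F y"
    using assms * by (auto simp: convex_on_def)
  also have "\<dots> \<le> u * k + v * k" using * by (intro add_mono mult_left_mono) auto
  also have "\<dots> = k" using * by (simp flip: distrib_right)
  finally show "u *\<^sub>R x + v *\<^sub>R y \<in> {y. F y \<le> k}" by simp
qed

text \<open>The derivative is monotone, so the interval where \<open>\<phi> \<le> k\<close> splits
  into two pieces on each of which it has constant sign. There the integral is a difference of two
  values of \<open>\<phi>\<close>, and these lie between 0 and \<open>k\<close>.\<close>

lemma convex_C1_abs_deriv_nn_integral_le:
  fixes \<phi> \<phi>' :: "real \<Rightarrow> real"
  assumes der: "\<And>t. (\<phi> has_real_derivative \<phi>' t) (at t)"
    and cont: "continuous_on UNIV \<phi>'"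
    and conv: "convex_on UNIV \<phi>" and nonneg: "\<And>t. 0 \<le> \<phi> t" and "0 \<le> k"
  shows "(\<integral>\<^sup>+ t. ennreal \<bar>\<phi>' t\<bar> * indicator {t. \<phi> t \<le> k} t * indicator {0..T} t \<partial>lborel)
     \<le> ennreal (2 * k)"
proof (cases "{t. \<phi> t \<le> k} \<inter> {0..T} = {}")
  case True
  then have "ennreal \<bar>\<phi>' t\<bar> * indicator {t. \<phi> t \<le> k} t * indicator {0..T} t = 0" for t
    by (auto simp: indicator_def)
  then have "(\<lambda>t. ennreal \<bar>\<phi>' t\<bar> * indicator {t. \<phi> t \<le> k} t * indicator {0..T} t) = (\<lambda>_. 0)"
    by blast
  then show ?thesis by simp
next
  case False
  define I where "I = {t. \<phi> t \<le> k} \<inter> {0..T}"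
  have [measurable]: "\<phi>' \<in> borel_measurable borel"
    using cont by (rule borel_measurable_continuous_onI)
  have cphi: "continuous_on UNIV \<phi>"
    using der by (meson DERIV_isCont continuous_at_imp_continuous_on)
  have "closed {t. \<phi> t \<le> k}"
    using closed_Collect_le[OF cphi continuous_on_const[of UNIV k]] by simp
  then have "compact I" unfolding I_def by (intro closed_Int_compact) auto
  moreover have "convex I"
  proof -
    have "convex {t. \<phi> t \<le> k}" by (rule convex_sublevel[OF conv])
    then show ?thesis unfolding I_def by (intro convex_Int) auto
  qed
  ultimately obtain a b where ab: "I = {a..b}"
    using connected_compact_interval_1[of I] convex_connected[of I] by auto
  have I_iff: "t \<in> {a..b} \<longleftrightarrow> \<phi> t \<le> k \<and> t \<in> {0..T}" for t
    unfolding ab[symmetric] I_def by simp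
  have "{a..b} \<noteq> {}" using False unfolding ab[symmetric] I_def .
  then have "a \<le> b" by simp
  have "\<phi> a \<le> k" "\<phi> b \<le> k" using I_iff[of a] I_iff[of b] \<open>a \<le> b\<close> by auto
  have \<phi>'_mono: "\<phi>' s \<le> \<phi>' t" if "s \<le> t" for s t
  proof (cases "s = t")
    case False
    have "\<phi> v \<ge> \<phi> u + \<phi>' u \<bullet> (v - u)" for u v
      using der[of u] by (intro convex_on_ge_tangent[OF conv]) (auto simp: has_field_derivative_def)
    from this[of s t] this[of t s] have "\<phi>' s * (t - s) \<le> \<phi>' t * (t - s)"
      by (simp add: algebra_simps)
    then show ?thesis using that False by simp
  qed simp
  have part: "(\<integral>\<^sup>+ t. ennreal \<bar>\<phi>' t\<bar> * indicator {x..y} t \<partial>lborel) \<le> ennreal k"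
    if "x \<le> y" "\<phi> x \<le> k" "\<phi> y \<le> k" "(\<forall>t\<in>{x..y}. \<phi>' t \<le> 0) \<or> (\<forall>t\<in>{x..y}. \<phi>' t \<ge> 0)" for x y
    using that(4)
  proof
    assume s: "\<forall>t\<in>{x..y}. \<phi>' t \<le> 0"
    have "(\<integral>\<^sup>+ t. ennreal \<bar>\<phi>' t\<bar> * indicator {x..y} t \<partial>lborel)
        = (\<integral>\<^sup>+ t. ennreal (- \<phi>' t) * indicator {x..y} t \<partial>lborel)"
      using s by (intro nn_integral_cong) (auto simp: indicator_def)
    also have "\<dots> = ennreal (- \<phi> y - (- \<phi> x))"
      using s that(1) by (intro nn_integral_FTC_Icc) (auto intro!: derivative_eq_intros der
          intro: has_field_derivative_at_within)
    also have "\<dots> \<le> ennreal k" using nonneg[of y] that by (intro ennreal_leI) auto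
    finally show ?thesis .
  next
    assume s: "\<forall>t\<in>{x..y}. \<phi>' t \<ge> 0"
    have "(\<integral>\<^sup>+ t. ennreal \<bar>\<phi>' t\<bar> * indicator {x..y} t \<partial>lborel)
        = (\<integral>\<^sup>+ t. ennreal (\<phi>' t) * indicator {x..y} t \<partial>lborel)"
      using s by (intro nn_integral_cong) (auto simp: indicator_def)
    also have "\<dots> = ennreal (\<phi> y - \<phi> x)"
      using s that(1) der by (intro nn_integral_FTC_Icc) auto
    also have "\<dots> \<le> ennreal k" using nonneg[of x] that by (intro ennreal_leI) auto
    finally show ?thesis .
  qed
  \<comment> \<open>The splitting point is a zero of \<open>\<phi>'\<close> if the derivative passes
    through 0; otherwise it is \<open>a\<close>, and the first piece degenerates to a point.\<close>
  have "\<exists>c\<in>{a..b}. ((\<forall>t\<in>{a..c}. \<phi>' t \<le> 0) \<or> (\<forall>t\<in>{a..c}. \<phi>' t \<ge> 0)) \<and>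
      ((\<forall>t\<in>{c..b}. \<phi>' t \<le> 0) \<or> (\<forall>t\<in>{c..b}. \<phi>' t \<ge> 0))"
  proof (cases "\<phi>' a \<le> 0 \<and> \<phi>' b \<ge> 0")
    case True
    then obtain c where "a \<le> c" "c \<le> b" "\<phi>' c = 0"
      using IVT'[of \<phi>' a 0 b] \<open>a \<le> b\<close> cont continuous_on_subset by blast
    then show ?thesis using \<phi>'_mono by (metis atLeastAtMost_iff)
  next
    case False
    then have "\<phi>' a > 0 \<or> \<phi>' b < 0" by auto
    then have "(\<forall>t\<in>{a..b}. \<phi>' t \<le> 0) \<or> (\<forall>t\<in>{a..b}. \<phi>' t \<ge> 0)"
      using \<phi>'_mono by (meson atLeastAtMost_iff order.trans less_imp_le)
    then show ?thesis using \<open>a \<le> b\<close> by (intro bexI[of _ a]) auto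
  qed
  then obtain c where c: "c \<in> {a..b}"
    and s: "(\<forall>t\<in>{a..c}. \<phi>' t \<le> 0) \<or> (\<forall>t\<in>{a..c}. \<phi>' t \<ge> 0)"
      "(\<forall>t\<in>{c..b}. \<phi>' t \<le> 0) \<or> (\<forall>t\<in>{c..b}. \<phi>' t \<ge> 0)" by blast
  have "\<phi> c \<le> k" using c I_iff by blast
  have "(\<integral>\<^sup>+ t. ennreal \<bar>\<phi>' t\<bar> * indicator {t. \<phi> t \<le> k} t * indicator {0..T} t \<partial>lborel)
     = (\<integral>\<^sup>+ t. ennreal \<bar>\<phi>' t\<bar> * indicator {a..b} t \<partial>lborel)"
    using I_iff by (intro nn_integral_cong) (auto simp: indicator_def)
  also have "\<dots> \<le> (\<integral>\<^sup>+ t. ennreal \<bar>\<phi>' t\<bar> * indicator {a..c} t + ennreal \<bar>\<phi>' t\<bar> * indicator {c..b} t \<partial>lborel)"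
    by (intro nn_integral_mono) (auto simp: indicator_def)
  also have "\<dots> = (\<integral>\<^sup>+ t. ennreal \<bar>\<phi>' t\<bar> * indicator {a..c} t \<partial>lborel)
      + (\<integral>\<^sup>+ t. ennreal \<bar>\<phi>' t\<bar> * indicator {c..b} t \<partial>lborel)"
    by (intro nn_integral_add) auto
  also have "\<dots> \<le> ennreal k + ennreal k"
    using c s \<open>\<phi> a \<le> k\<close> \<open>\<phi> b \<le> k\<close> \<open>\<phi> c \<le> k\<close> by (intro add_mono part) auto
  also have "\<dots> = ennreal (2 * k)" using \<open>0 \<le> k\<close> by (simp flip: ennreal_plus)
  finally show ?thesis .
qed

text \<open>After \<open>s\<close> the function must climb from at most \<open>k / 2\<close> to
  \<open>k\<close> before \<open>T\<close>. Up to a point \<open>r\<close> where it equals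
  \<open>k\<close>, convexity keeps it at most \<open>k\<close>, so the climb is counted in
  full.\<close>

lemma convex_C1_abs_deriv_nn_integral_ge:
  fixes \<phi> \<phi>' :: "real \<Rightarrow> real"
  assumes der: "\<And>t. (\<phi> has_real_derivative \<phi>' t) (at t)"
    and cont: "continuous_on UNIV \<phi>'"
    and conv: "convex_on UNIV \<phi>"
    and s: "s \<in> {0..T}" "\<phi> s \<le> k / 2" "\<phi> T > k" and "0 \<le> k"
  shows "ennreal (k / 2) \<le>
    (\<integral>\<^sup>+ t. ennreal \<bar>\<phi>' t\<bar> * indicator {t. \<phi> t \<le> k} t * indicator {0..T} t \<partial>lborel)"
proof -
  have [measurable]: "\<phi>' \<in> borel_measurable borel"
    using cont by (rule borel_measurable_continuous_onI)
  have cphi: "continuous_on UNIV \<phi>"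
    using der by (meson DERIV_isCont continuous_at_imp_continuous_on)
  obtain r where r: "s \<le> r" "r \<le> T" "\<phi> r = k"
    using IVT'[of \<phi> s k T] s \<open>0 \<le> k\<close> continuous_on_subset[OF cphi] by auto
  have le: "\<phi> t \<le> k" if "t \<in> {s..r}" for t
  proof -
    have "\<phi> t \<le> max (\<phi> s) (\<phi> r)"
      by (rule convex_on_le_max[of s r]) (use that convex_on_subset[OF conv] in auto)
    then show ?thesis using s r \<open>0 \<le> k\<close> by auto
  qed
  have "(\<phi>' has_integral (\<phi> r - \<phi> s)) {s..r}"
    using r(1) der by (intro fundamental_theorem_of_calculus)
      (auto simp: has_real_derivative_iff_has_vector_derivative[symmetric] intro: has_field_derivative_at_within)
  moreover have ai: "(\<lambda>t. \<bar>\<phi>' t\<bar>) integrable_on {s..r}"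
    using continuous_on_subset[OF cont] by (intro integrable_continuous_interval continuous_intros) auto
  ultimately have "\<phi> r - \<phi> s \<le> integral {s..r} (\<lambda>t. \<bar>\<phi>' t\<bar>)"
    using has_integral_le[of \<phi>' _ "{s..r}" "\<lambda>t. \<bar>\<phi>' t\<bar>"] by (metis abs_ge_self integrable_integral)
  then have "ennreal (k / 2) \<le> ennreal (integral {s..r} (\<lambda>t. \<bar>\<phi>' t\<bar>))"
    using s r by (intro ennreal_leI) auto
  also have "\<dots> = (\<integral>\<^sup>+ t. ennreal (\<bar>\<phi>' t\<bar> * indicator {s..r} t) \<partial>lborel)"
  proof (rule nn_integral_has_integral_lborel[symmetric])
    show "((\<lambda>t. \<bar>\<phi>' t\<bar> * indicator {s..r} t) has_integral integral {s..r} (\<lambda>t. \<bar>\<phi>' t\<bar>)) UNIV"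
      using integrable_integral[OF ai] by (subst (asm) has_integral_restrict_UNIV[symmetric])
        (simp add: indicator_def if_distrib[of "\<lambda>x. _ * x"] of_bool_def cong: if_cong)
  qed auto
  also have "\<dots> \<le> (\<integral>\<^sup>+ t. ennreal \<bar>\<phi>' t\<bar> * indicator {t. \<phi> t \<le> k} t * indicator {0..T} t \<partial>lborel)"
    using le s r by (intro nn_integral_mono) (auto simp: indicator_def)
  finally show ?thesis .
qed

section \<open>Growth of convex functions\<close>

locale convex_C1 =
  fixes F :: "'a::euclidean_space \<Rightarrow> real" and G :: "'a \<Rightarrow> 'a"
  assumes convex_F: "convex_on UNIV F"
    and F_deriv: "\<And>x. (F has_derivative (\<lambda>h. G x \<bullet> h)) (at x)"
    and continuous_G: "continuous_on UNIV G"
begin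

lemma continuous_F: "continuous_on UNIV F"
  using F_deriv by (meson has_derivative_continuous continuous_at_imp_continuous_on)

lemma borel_F [measurable]: "F \<in> borel_measurable borel"
  using continuous_F by (rule borel_measurable_continuous_onI)

lemma borel_G [measurable]: "G \<in> borel_measurable borel"
  using continuous_G by (rule borel_measurable_continuous_onI)

lemma tangent_le: "F x + G x \<bullet> (y - x) \<le> F y"
  by (rule convex_on_ge_tangent[OF convex_F F_deriv])

lemma closed_sublevel: "closed {y. F y \<le> k}"
  using closed_Collect_le[OF continuous_F continuous_on_const[of UNIV k]] by simp

lemma F_convex_comb: "0 \<le> t \<Longrightarrow> t \<le> 1 \<Longrightarrow> F ((1 - t) *\<^sub>R x + t *\<^sub>R y) \<le> (1 - t) * F x + t * F y"
  using convex_onD[OF convex_F, of t x y] by auto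

lemma line_deriv: "((\<lambda>t. F (y + t *\<^sub>R b)) has_real_derivative (G (y + t *\<^sub>R b) \<bullet> b)) (at t)"
proof -
  have "((\<lambda>t. F (y + t *\<^sub>R b)) has_derivative (\<lambda>h. G (y + t *\<^sub>R b) \<bullet> (h *\<^sub>R b))) (at t)"
    by (rule has_derivative_compose[where f="\<lambda>t. y + t *\<^sub>R b"]) (auto intro!: derivative_eq_intros F_deriv)
  then show ?thesis by (simp add: has_field_derivative_def mult_commute_abs)
qed

lemma line_convex: "convex_on UNIV (\<lambda>t. F (y + t *\<^sub>R b))"
proof (rule convex_onI)
  fix t x z :: real assume "0 < t" "t < 1"
  then show "F (y + ((1 - t) *\<^sub>R x + t *\<^sub>R z) *\<^sub>R b) \<le> (1 - t) * F (y + x *\<^sub>R b) + t * F (y + z *\<^sub>R b)"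
    using F_convex_comb[of t "y + x *\<^sub>R b" "y + z *\<^sub>R b"] by (simp add: algebra_simps)
qed simp

lemma line_continuous_deriv: "continuous_on UNIV (\<lambda>t. G (y + t *\<^sub>R b) \<bullet> b)"
  by (intro continuous_intros continuous_on_compose2[OF continuous_G]) auto

text \<open>Each segment from \<open>y\<close> to \<open>y + T *\<^sub>R b\<close> contributes at
  most \<open>2 * k\<close>, and only those starting in \<open>Z\<close> meet the sublevel
  set.\<close>

lemma dir_deriv_nn_integral_le:
  assumes nonneg: "\<And>y. 0 \<le> F y" and "0 \<le> k" "0 \<le> T" and [measurable]: "Z \<in> sets borel"
    and Z: "\<And>y t. t \<in> {0..T} \<Longrightarrow> F (y + t *\<^sub>R b) \<le> k \<Longrightarrow> y \<in> Z"
  shows "ennreal T * (\<integral>\<^sup>+ y. ennreal \<bar>G y \<bullet> b\<bar> * indicator {y. F y \<le> k} y \<partial>lborel)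
     \<le> ennreal (2 * k) * emeasure lborel Z"
proof -
  have "ennreal T * (\<integral>\<^sup>+ y. ennreal \<bar>G y \<bullet> b\<bar> * indicator {y. F y \<le> k} y \<partial>lborel)
    = (\<integral>\<^sup>+ y. (\<integral>\<^sup>+ t. ennreal \<bar>G (y + t *\<^sub>R b) \<bullet> b\<bar> * indicator {y. F y \<le> k} (y + t *\<^sub>R b)
          * indicator {0..T} t \<partial>lborel) \<partial>lborel)"
    using \<open>0 \<le> T\<close> by (intro nn_integral_lborel_line_average) auto
  also have "\<dots> \<le> (\<integral>\<^sup>+ y. ennreal (2 * k) * indicator Z y \<partial>lborel)"
  proof (rule nn_integral_mono)
    fix y
    show "(\<integral>\<^sup>+ t. ennreal \<bar>G (y + t *\<^sub>R b) \<bullet> b\<bar> * indicator {y. F y \<le> k} (y + t *\<^sub>R b)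
          * indicator {0..T} t \<partial>lborel) \<le> ennreal (2 * k) * indicator Z y"
    proof (cases "y \<in> Z")
      case True
      have "(\<integral>\<^sup>+ t. ennreal \<bar>G (y + t *\<^sub>R b) \<bullet> b\<bar> * indicator {t. F (y + t *\<^sub>R b) \<le> k} t
          * indicator {0..T} t \<partial>lborel) \<le> ennreal (2 * k)"
        using line_deriv line_continuous_deriv line_convex nonneg \<open>0 \<le> k\<close>
        by (rule convex_C1_abs_deriv_nn_integral_le)
      then show ?thesis using True by (simp add: indicator_def)
    next
      case False
      then have "ennreal \<bar>G (y + t *\<^sub>R b) \<bullet> b\<bar> * indicator {y. F y \<le> k} (y + t *\<^sub>R b)
          * indicator {0..T} t = 0" for t
        using Z[of t y] by (auto simp: indicator_def)
      then show ?thesis by (simp only: nn_integral_const) simp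
    qed
  qed
  also have "\<dots> = ennreal (2 * k) * emeasure lborel Z"
    by (simp add: nn_integral_cmult)
  finally show ?thesis .
qed

text \<open>The reverse estimate: a segment starting in \<open>Z\<close> passes from a value of at
  most \<open>k / 2\<close> to one above \<open>k\<close>, hence contributes at least
  \<open>k / 2\<close>.\<close>

lemma dir_deriv_nn_integral_ge:
  assumes "0 \<le> k" "0 \<le> T" and [measurable]: "Z \<in> sets borel"
    and Z: "\<And>y. y \<in> Z \<Longrightarrow> F (y + T *\<^sub>R b) > k \<and> (\<exists>s\<in>{0..T}. F (y + s *\<^sub>R b) \<le> k / 2)"
  shows "ennreal (k / 2) * emeasure lborel Z
     \<le> ennreal T * (\<integral>\<^sup>+ y. ennreal \<bar>G y \<bullet> b\<bar> * indicator {y. F y \<le> k} y \<partial>lborel)"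
proof -
  have "ennreal (k / 2) * emeasure lborel Z = (\<integral>\<^sup>+ y. ennreal (k / 2) * indicator Z y \<partial>lborel)"
    by (simp add: nn_integral_cmult)
  also have "\<dots> \<le> (\<integral>\<^sup>+ y. (\<integral>\<^sup>+ t. ennreal \<bar>G (y + t *\<^sub>R b) \<bullet> b\<bar> * indicator {y. F y \<le> k} (y + t *\<^sub>R b)
          * indicator {0..T} t \<partial>lborel) \<partial>lborel)"
  proof (rule nn_integral_mono)
    fix y
    show "ennreal (k / 2) * indicator Z y \<le> (\<integral>\<^sup>+ t. ennreal \<bar>G (y + t *\<^sub>R b) \<bullet> b\<bar>
        * indicator {y. F y \<le> k} (y + t *\<^sub>R b) * indicator {0..T} t \<partial>lborel)"
    proof (cases "y \<in> Z")
      case True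
      then obtain s where "s \<in> {0..T}" "F (y + s *\<^sub>R b) \<le> k / 2" "F (y + T *\<^sub>R b) > k"
        using Z by blast
      from convex_C1_abs_deriv_nn_integral_ge[OF line_deriv line_continuous_deriv line_convex this \<open>0 \<le> k\<close>]
      have "ennreal (k / 2) \<le> (\<integral>\<^sup>+ t. ennreal \<bar>G (y + t *\<^sub>R b) \<bullet> b\<bar>
        * indicator {t. F (y + t *\<^sub>R b) \<le> k} t * indicator {0..T} t \<partial>lborel)" .
      then show ?thesis using True by (simp add: indicator_def)
    qed simp
  qed
  also have "\<dots> = ennreal T * (\<integral>\<^sup>+ y. ennreal \<bar>G y \<bullet> b\<bar> * indicator {y. F y \<le> k} y \<partial>lborel)"
    using \<open>0 \<le> T\<close> by (intro nn_integral_lborel_line_average[symmetric]) auto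
  finally show ?thesis .
qed

end

section \<open>Sublevel sets and growth around a minimum\<close>

locale convex_C1_min = convex_C1 +
  assumes F_nonneg: "\<And>y. 0 \<le> F y" and F_zero: "F 0 = 0"
begin

lemma F_scale_le:
  assumes "0 \<le> t" "t \<le> 1"
  shows "F (t *\<^sub>R y) \<le> t * F y"
  using F_convex_comb[OF assms, of 0 y] F_zero by simp

lemma sublevel_contains_ball:
  assumes "k > 0"
  obtains r where "r > 0" "cball 0 r \<subseteq> {y. F y \<le> k}"
proof -
  have "open {y. F y < k}"
    using open_Collect_less[OF continuous_F continuous_on_const[of UNIV k]] by simp
  moreover have "0 \<in> {y. F y < k}" using assms F_zero by simp
  ultimately obtain r where "r > 0" "cball 0 r \<subseteq> {y. F y < k}"
    using open_contains_cball by blast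
  then show ?thesis by (intro that[of r]) auto
qed

lemma sublevel_emeasure_pos:
  assumes "k > 0"
  shows "emeasure lborel {y. F y \<le> k} > 0"
proof -
  obtain r where r: "r > 0" "cball 0 r \<subseteq> {y. F y \<le> k}" using sublevel_contains_ball[OF assms] .
  have "0 < emeasure lborel (cball (0::'a) r)" using r by (simp add: emeasure_cball)
  also have "\<dots> \<le> emeasure lborel {y. F y \<le> k}" using r by (intro emeasure_mono) auto
  finally show ?thesis .
qed

text \<open>An unbounded convex set with interior has infinite volume: far away points force
  many disjoint translates of a fixed ball into the set.\<close>
lemma bounded_sublevel:
  assumes fin: "emeasure lborel {y. F y \<le> 1} < \<infinity>"
  shows "bounded {y. F y \<le> 1}"
proof (rule ccontr)
  assume unb: "\<not> bounded {y. F y \<le> 1}"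
  obtain r where r: "r > 0" "cball 0 r \<subseteq> {y. F y \<le> 1}" using sublevel_contains_ball[of 1] by auto
  define V where "V = measure lborel (cball (0::'a) (r/2))"
  have V: "emeasure lborel (cball (0::'a) (r/2)) = ennreal V" "V > 0"
    using r emeasure_lborel_cball_finite[of "0::'a" "r/2"] unfolding V_def
    by (auto intro!: emeasure_eq_ennreal_measure content_cball_pos)
  obtain M where M: "emeasure lborel {y. F y \<le> 1} = ennreal M" "M \<ge> 0"
    using fin by (metis ennreal_cases infinity_ennreal_def less_irrefl)
  obtain N :: nat where N: "real N * V > M" using reals_Archimedean3[OF V(2)] by blast
  then have "N > 0" using M by (cases N) auto
  from unb obtain z where z: "F z \<le> 1" "norm z > 2 * real N * r"
    unfolding bounded_iff by (auto simp: not_le)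
  have "norm z > 0" using z(2) r(1) by (smt (verit) mult_nonneg_nonneg of_nat_0_le_iff)
  \<comment> \<open>The multiples of \<open>w\<close> by \<open>j < N\<close> stay in the first half
    of the segment from 0 to \<open>z\<close>, so the balls of radius \<open>r / 2\<close> around
    them lie in the convex hull of \<open>z\<close> and the ball of radius \<open>r\<close>. The
    size of \<open>norm z\<close> keeps them disjoint.\<close>
  define w where "w = (1 / (2 * real N)) *\<^sub>R z"
  have "of_nat N * emeasure lborel (cball (0::'a) (r/2)) \<le> emeasure lborel {y. F y \<le> 1}"
  proof (rule emeasure_disjoint_translates_le[where l=z and w=w and c=0])
    fix y y' :: 'a assume "y \<in> cball 0 (r/2)" "y' \<in> cball 0 (r/2)"
    then have "norm (y - y') \<le> r" by (auto intro: norm_triangle_le_diff order_trans[OF norm_triangle_ineq4])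
    then have "z \<bullet> (y - y') \<le> norm z * r"
      by (meson norm_cauchy_schwarz mult_left_mono norm_ge_zero order_trans)
    also have "\<dots> < norm z * (norm z / (2 * real N))"
      using z(2) \<open>N > 0\<close> \<open>norm z > 0\<close> by (intro mult_strict_left_mono) (auto simp: field_simps)
    also have "\<dots> = z \<bullet> w" by (simp add: w_def power2_norm_eq_inner[symmetric] power2_eq_square)
    finally show "z \<bullet> (y - y') < z \<bullet> w" .
  next
    fix y :: 'a and j assume y: "y \<in> cball 0 (r/2)" "j < N"
    define t where "t = real j / (2 * real N)"
    have t: "0 \<le> t" "t \<le> 1/2" using y unfolding t_def by (auto simp: field_simps)
    have "norm ((1 / (1 - t)) *\<^sub>R y) = norm y / (1 - t)" using t by simp
    also have "\<dots> \<le> (r/2) / (1/2)" using y t r by (intro frac_le) auto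
    finally have "(1 / (1 - t)) *\<^sub>R y \<in> cball 0 r" by simp
    then have "F ((1 / (1 - t)) *\<^sub>R y) \<le> 1" using r(2) by blast
    moreover have "F ((1 - t) *\<^sub>R ((1 / (1 - t)) *\<^sub>R y) + t *\<^sub>R z)
        \<le> (1 - t) * F ((1 / (1 - t)) *\<^sub>R y) + t * F z"
      using t by (intro F_convex_comb) auto
    moreover have "(1 - t) * F ((1 / (1 - t)) *\<^sub>R y) + t * F z \<le> (1 - t) * 1 + t * 1"
      using t z calculation(1) by (intro add_mono mult_left_mono) auto
    ultimately have "F ((1 - t) *\<^sub>R ((1 / (1 - t)) *\<^sub>R y) + t *\<^sub>R z) \<le> 1" by simp
    moreover have "(1 - t) *\<^sub>R ((1 / (1 - t)) *\<^sub>R y) = y" using t by simp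
    moreover have "t *\<^sub>R z = real j *\<^sub>R w" by (simp add: w_def t_def)
    ultimately show "y + (0 + real j *\<^sub>R w) \<in> {y. F y \<le> 1}" by (metis add_0 mem_Collect_eq)
  qed (use closed_sublevel in auto)
  then have "ennreal (real N * V) \<le> ennreal M"
    unfolding V M by (simp add: ennreal_mult' ennreal_of_nat_eq_real_of_nat)
  then show False using N M V by (simp add: ennreal_le_iff)
qed

text \<open>Beyond the sphere of radius \<open>\<rho>\<close>, where \<open>F\<close> exceeds 1,
  convexity along rays and \<open>F 0 = 0\<close> force growth at least proportional to the
  distance. Inside, the lower bound is not positive.\<close>

lemma linear_growth:
  assumes "emeasure lborel {y. F y \<le> 1} < \<infinity>"
  obtains a where "a > 0" "\<And>y. F y \<ge> a * norm y - 1"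
proof -
  obtain \<rho> where \<rho>: "\<rho> > 0" "\<And>y. F y \<le> 1 \<Longrightarrow> norm y < \<rho>"
    using bounded_sublevel[OF assms] unfolding bounded_pos_less by auto
  have "F y \<ge> (1/\<rho>) * norm y - 1" for y
  proof (cases "norm y \<ge> \<rho>")
    case True
    have "norm ((\<rho> / norm y) *\<^sub>R y) = \<rho>" using True \<rho>(1) by auto
    then have "1 < F ((\<rho> / norm y) *\<^sub>R y)" using \<rho>(2)[of "(\<rho> / norm y) *\<^sub>R y"] by linarith
    also have "\<dots> \<le> (\<rho> / norm y) * F y"
      using True \<rho>(1) by (intro F_scale_le) (auto simp: divide_le_eq)
    finally have "1 < (\<rho> / norm y) * F y" .
    moreover have "norm y > 0" using True \<rho>(1) by linarith
    ultimately have "norm y / \<rho> < F y" using \<rho>(1) by (simp add: field_simps)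
    then show ?thesis by simp
  next
    case False
    then have "(1/\<rho>) * norm y \<le> 1" using \<rho>(1) by (simp add: field_simps)
    then show ?thesis using F_nonneg[of y] by linarith
  qed
  then show ?thesis using \<rho>(1) by (intro that[of "1/\<rho>"]) auto
qed

text \<open>The direction is a limit of normalised points at which linear lower bounds with slopes
  decreasing to \<open>\<theta>\<close> fail.\<close>
lemma slowest_direction:
  assumes fail: "\<And>a b. a > \<theta> \<Longrightarrow> \<exists>y. F y < a * norm y - b" and "\<theta> \<ge> 0"
  obtains v where "norm v = 1" "\<And>y s. s \<ge> 0 \<Longrightarrow> F (y + s *\<^sub>R v) \<le> F y + s * \<theta>"
proof -
  \<comment> \<open>The slopes tend to \<open>\<theta>\<close>, while the growing intercept
    \<open>real j\<close> drives the norms of the points found to infinity, because \<open>F\<close>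
    is nonnegative.\<close>
  have "\<exists>y. F y < (\<theta> + 1 / Suc j) * norm y - real j" for j
    by (rule fail) simp
  then obtain z where z: "\<And>j. F (z j) < (\<theta> + 1 / Suc j) * norm (z j) - real j" by metis
  have z_large: "norm (z j) \<ge> real j / (\<theta> + 1)" for j
  proof -
    have "real j \<le> (\<theta> + 1 / Suc j) * norm (z j)" using z[of j] F_nonneg[of "z j"] by linarith
    also have "\<dots> \<le> (\<theta> + 1) * norm (z j)" by (intro mult_right_mono) auto
    finally show ?thesis using \<open>\<theta> \<ge> 0\<close> by (simp add: divide_le_eq mult.commute)
  qed
  have zpos: "norm (z j) > 0" for j
    using z[of j] F_nonneg[of "z j"] by (cases "z j = 0") auto
  have "seq_compact (sphere (0::'a) 1)" by (simp add: compact_imp_seq_compact)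
  moreover have "\<forall>j. z j /\<^sub>R norm (z j) \<in> sphere 0 1" using zpos by simp
  ultimately obtain v r where v: "v \<in> sphere 0 1" "strict_mono r"
     "((\<lambda>j. z j /\<^sub>R norm (z j)) \<circ> r) \<longlonglongrightarrow> v"
    by (rule seq_compactE[where f="\<lambda>j. z j /\<^sub>R norm (z j)"])
  have inf0: "filterlim (\<lambda>j. norm (z j)) at_top sequentially"
  proof (rule filterlim_at_top_mono)
    show "filterlim (\<lambda>j. real j / (\<theta> + 1)) at_top sequentially"
      unfolding divide_inverse using \<open>\<theta> \<ge> 0\<close>
      by (intro filterlim_at_top_mult_tendsto_pos[OF tendsto_const _ filterlim_real_sequentially]) auto
  qed (use z_large in auto)
  have inf: "filterlim (\<lambda>j. norm (z (r j))) at_top sequentially"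
    using filterlim_compose[OF inf0 filterlim_subseq[OF v(2)]] by (simp add: o_def)
  have "F (y + s *\<^sub>R v) \<le> F y + s * \<theta>" if s: "s \<ge> 0" for y s
  proof -
    \<comment> \<open>With weight \<open>t j\<close>, the point on the segment from \<open>y\<close>
      to \<open>z (r j)\<close> approaches \<open>y + s *\<^sub>R v\<close>, and the convexity bound
      for its value approaches \<open>F y + s * \<theta>\<close>.\<close>
    define t where "t j = s / norm (z (r j))" for j
    have t0: "t \<longlonglongrightarrow> 0" unfolding t_def by (rule tendsto_divide_0[OF tendsto_const filterlim_at_top_imp_at_infinity[OF inf]])
    have "(\<lambda>j. (1 - t j) *\<^sub>R y + s *\<^sub>R (z (r j) /\<^sub>R norm (z (r j)))) \<longlonglongrightarrow> (1 - 0) *\<^sub>R y + s *\<^sub>R v"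
      using v(3) by (intro tendsto_intros t0) (simp add: o_def)
    then have lim0: "(\<lambda>j. F ((1 - t j) *\<^sub>R y + s *\<^sub>R (z (r j) /\<^sub>R norm (z (r j))))) \<longlonglongrightarrow> F ((1 - 0) *\<^sub>R y + s *\<^sub>R v)"
      by (rule continuous_on_tendsto_compose[OF continuous_F]) auto
    have e: "s *\<^sub>R (z (r j) /\<^sub>R norm (z (r j))) = t j *\<^sub>R z (r j)" for j
      by (simp add: t_def divide_inverse)
    have lim: "(\<lambda>j. F ((1 - t j) *\<^sub>R y + t j *\<^sub>R z (r j))) \<longlonglongrightarrow> F (y + s *\<^sub>R v)"
      using lim0 unfolding e by simp
    have lim2: "(\<lambda>j. (1 - t j) * F y + s * (\<theta> + 1 / Suc (r j))) \<longlonglongrightarrow> (1 - 0) * F y + s * (\<theta> + 0)"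
      using LIMSEQ_subseq_LIMSEQ[OF LIMSEQ_inverse_real_of_nat v(2)]
      by (intro tendsto_intros t0) (simp add: o_def divide_inverse)
    have "eventually (\<lambda>j. norm (z (r j)) \<ge> s) sequentially"
      using inf by (auto simp: filterlim_at_top)
    then have ev: "eventually (\<lambda>j. F ((1 - t j) *\<^sub>R y + t j *\<^sub>R z (r j)) \<le> (1 - t j) * F y + s * (\<theta> + 1 / Suc (r j))) sequentially"
    proof eventually_elim
      case (elim j)
      have tj: "0 \<le> t j" "t j \<le> 1" using elim s zpos[of "r j"] unfolding t_def by (auto simp: divide_le_eq)
      have "t j * F (z (r j)) \<le> t j * ((\<theta> + 1 / Suc (r j)) * norm (z (r j)))"
        using z[of "r j"] tj by (intro mult_left_mono) auto
      also have "\<dots> = s * (\<theta> + 1 / Suc (r j))" using zpos[of "r j"] by (simp add: t_def)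
      finally show ?case using F_convex_comb[OF tj, of y "z (r j)"] by linarith
    qed
    show ?thesis using tendsto_le[OF sequentially_bot lim2 lim ev] by simp
  qed
  then show ?thesis using v(1) by (intro that[of v]) auto
qed

end

section \<open>Area of sections\<close>

context convex_C1
begin

text \<open>A section by a plane of slope \<open>p\<close> is a sublevel set of the tilted function,
  so estimates for sublevel sets transfer to sections at any point.\<close>

lemma tilted: "convex_C1 (\<lambda>y. F y - p \<bullet> y - m) (\<lambda>y. G y - p)"
proof
  show "convex_on UNIV (\<lambda>y. F y - p \<bullet> y - m)"
  proof (rule convex_onI)
    fix t :: real and x y :: 'a assume "0 < t" "t < 1"
    then show "F ((1 - t) *\<^sub>R x + t *\<^sub>R y) - p \<bullet> ((1 - t) *\<^sub>R x + t *\<^sub>R y) - m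
        \<le> (1 - t) * (F x - p \<bullet> x - m) + t * (F y - p \<bullet> y - m)"
      using F_convex_comb[of t x y] by (simp add: algebra_simps inner_simps)
  qed simp
  show "((\<lambda>y. F y - p \<bullet> y - m) has_derivative (\<lambda>h. (G x - p) \<bullet> h)) (at x)" for x
    by (auto intro!: derivative_eq_intros F_deriv simp: inner_simps)
  show "continuous_on UNIV (\<lambda>y. G y - p)"
    by (intro continuous_intros continuous_G)
qed

lemma grad_eq_zero_at_min:
  assumes "\<And>y. F x \<le> F y"
  shows "G x = 0"
proof -
  have "(\<lambda>h. G x \<bullet> h) = (\<lambda>h. 0)"
    using assms by (intro differential_zero_maxmin[of x UNIV F]) (auto intro: F_deriv)
  then have "G x \<bullet> G x = 0" by metis
  then show ?thesis by simp
qed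

lemma slope_attained:
  assumes "e > 0" and growth: "\<And>y. F y - p \<bullet> y \<ge> e * norm y - B"
  obtains x where "G x = p" "\<And>y. F x - p \<bullet> x \<le> F y - p \<bullet> y"
proof -
  interpret T: convex_C1 "\<lambda>y. F y - p \<bullet> y - 0" "\<lambda>y. G y - p" by (rule tilted)
  \<comment> \<open>Outside the ball of radius \<open>R\<close> the growth bound gives values of at
    least \<open>F 0\<close>, so a minimum over the ball is global. The absolute value
    \<open>\<bar>R\<bar>\<close> keeps the origin in the ball even if \<open>R\<close> is
    negative.\<close>
  define R where "R = (B + \<bar>F 0\<bar>) / e"
  have "\<exists>x\<in>cball 0 \<bar>R\<bar>. \<forall>y\<in>cball 0 \<bar>R\<bar>. F x - p \<bullet> x - 0 \<le> F y - p \<bullet> y - 0"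
    by (intro continuous_attains_inf continuous_on_subset[OF T.continuous_F]) auto
  then obtain x where x: "\<And>y. norm y \<le> \<bar>R\<bar> \<Longrightarrow> F x - p \<bullet> x \<le> F y - p \<bullet> y"
    by (auto simp: Ball_def)
  have min: "F x - p \<bullet> x \<le> F y - p \<bullet> y" for y
  proof (cases "norm y \<le> \<bar>R\<bar>")
    case False
    then have "R \<le> norm y" by linarith
    then have "B + \<bar>F 0\<bar> \<le> e * norm y" using \<open>e > 0\<close> by (simp add: R_def divide_le_eq mult.commute)
    then have "F 0 - p \<bullet> 0 \<le> F y - p \<bullet> y" using growth[of y] by simp
    then show ?thesis using x[of 0] by simp
  qed (rule x)
  then have "G x - p = 0" by (intro T.grad_eq_zero_at_min) auto
  with min show ?thesis by (intro that[of x]) auto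
qed

end

text \<open>\<open>W\<close> is abstract and only comparable to \<open>1 + norm (G y)\<close>:
  removing the tangent plane shifts the gradient by a constant, while the area density is still
  built from the original gradient. In \<open>area_eq\<close> only the upper plane appears, since a
  convex graph lies above its tangents.\<close>

locale section_area = convex_C1_min F G
  for F :: "'a::euclidean_space \<Rightarrow> real" and G :: "'a \<Rightarrow> 'a" +
  fixes W :: "'a \<Rightarrow> real" and c :: real and \<eta> :: "real \<Rightarrow> real"
  assumes continuous_W: "continuous_on UNIV W" and W_ge_1: "\<And>y. 1 \<le> W y"
    and G_le_W: "\<And>y. norm (G y) \<le> c * W y" and W_le_G: "\<And>y. W y \<le> c * (1 + norm (G y))"
    and \<eta>_nonneg: "\<And>k. k > 0 \<Longrightarrow> 0 \<le> \<eta> k"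
    and area_eq: "\<And>x k. k > 0 \<Longrightarrow>
      (\<integral>\<^sup>+ y. ennreal (W y) * indicator {y. F y \<le> F x + G x \<bullet> (y - x) + k} y \<partial>lborel) = ennreal (W x * \<eta> k)"
begin

definition area :: "'a \<Rightarrow> real \<Rightarrow> ennreal" where
  "area x k = (\<integral>\<^sup>+ y. ennreal (W y) * indicator {y. F y \<le> F x + G x \<bullet> (y - x) + k} y \<partial>lborel)"

text \<open>The volume of \<open>shadow b k h\<close> replaces \<open>k\<close> times the volume of the projection of the
  sublevel set along \<open>b\<close>, so that no product decomposition of the space is needed.\<close>
definition shadow :: "'a \<Rightarrow> real \<Rightarrow> real \<Rightarrow> 'a set" where
  "shadow b k h = {y. \<exists>t\<in>{0..k}. F (y + t *\<^sub>R b) \<le> h}"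

lemma area: "k > 0 \<Longrightarrow> area x k = ennreal (W x * \<eta> k)"
  unfolding area_def by (rule area_eq)

lemma borel_W [measurable]: "W \<in> borel_measurable borel"
  using continuous_W by (rule borel_measurable_continuous_onI)

lemma section_eq: "{y. F y \<le> F x + G x \<bullet> (y - x) + k} = {y. F y - G x \<bullet> y - (F x - G x \<bullet> x) \<le> k}"
  by (auto simp: inner_diff_right)

lemma section_measurable [measurable]: "{y. F y \<le> F x + G x \<bullet> (y - x) + k} \<in> sets borel"
  unfolding section_eq using convex_C1.closed_sublevel[OF tilted] by (intro borel_closed)

lemma G_zero: "G 0 = 0"
  by (rule grad_eq_zero_at_min) (simp add: F_zero F_nonneg)

lemma area_zero: "area 0 k = (\<integral>\<^sup>+ y. ennreal (W y) * indicator {y. F y \<le> k} y \<partial>lborel)"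
  by (simp add: area_def G_zero F_zero)

lemma c_pos: "c > 0"
proof -
  have "1 \<le> c * (1 + norm (G 0))" using W_ge_1 W_le_G order_trans by blast
  then show ?thesis by (simp add: G_zero)
qed

lemma emeasure_section_le_area:
  "emeasure lborel {y. F y \<le> F x + G x \<bullet> (y - x) + k} \<le> area x k"
proof -
  have "emeasure lborel {y. F y \<le> F x + G x \<bullet> (y - x) + k}
      = (\<integral>\<^sup>+ y. indicator {y. F y \<le> F x + G x \<bullet> (y - x) + k} y \<partial>lborel)" by simp
  also have "\<dots> \<le> area x k" unfolding area_def
    using W_ge_1 by (intro nn_integral_mono) (auto simp: indicator_def)
  finally show ?thesis .
qed

lemma finite_sublevel: "emeasure lborel {y. F y \<le> 1} < \<infinity>"
proof -
  have "emeasure lborel {y. F y \<le> 1} \<le> area 0 1"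
    using emeasure_section_le_area[of 0 1] by (simp add: G_zero F_zero)
  then show ?thesis by (simp add: area le_less_trans)
qed

lemma compact_sublevel: "compact {y. F y \<le> k}"
proof -
  obtain a where a: "a > 0" "\<And>y. F y \<ge> a * norm y - 1" using linear_growth[OF finite_sublevel] by blast
  have "norm y \<le> (k + 1) / a" if "F y \<le> k" for y
    using a(1) a(2)[of y] that by (simp add: field_simps)
  then show ?thesis using closed_sublevel by (auto simp: compact_eq_bounded_closed bounded_iff)
qed

lemma compact_shadow: "compact (shadow b k h)"
proof -
  have "shadow b k h = (\<Union>x\<in>{y. F y \<le> h}. \<Union>z\<in>(\<lambda>t. t *\<^sub>R b) ` {0..k}. {x - z})"
    unfolding shadow_def by (force simp: algebra_simps)
  also have "\<dots> = {x - z |x z. x \<in> {y. F y \<le> h} \<and> z \<in> (\<lambda>t. t *\<^sub>R b) ` {0..k}}" by blast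
  also have "compact \<dots>"
    by (intro compact_differences compact_sublevel compact_continuous_image continuous_intros) auto
  finally show ?thesis .
qed

lemma borel_shadow [measurable]: "shadow b k h \<in> sets borel"
  using compact_shadow by (rule borel_compact)

lemma sublevel_subset_shadow: "0 \<le> k \<Longrightarrow> {y. F y \<le> h} \<subseteq> shadow b k h"
  unfolding shadow_def by (auto intro!: bexI[of _ 0])

text \<open>\<open>W\<close> is at most \<open>c\<close> times the sum of 1 and the absolute partial
  derivatives. Averaging over segments of length \<open>k\<close> bounds the integral of each
  derivative by twice a shadow volume, and the term 1 costs at most one more, whence the factor
  3.\<close>

lemma area_zero_le:
  assumes "k > 0"
  shows "area 0 k \<le> ennreal (3 * c) * (\<Sum>b\<in>Basis. emeasure lborel (shadow b k k))"
proof -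
  let ?R = "{y. F y \<le> k}" and ?S = "\<Sum>b\<in>Basis. emeasure lborel (shadow b k k)"
  have R[measurable]: "?R \<in> sets borel" using closed_sublevel by (intro borel_closed)
  have dir: "(\<integral>\<^sup>+ y. ennreal \<bar>G y \<bullet> b\<bar> * indicator ?R y \<partial>lborel) \<le> 2 * emeasure lborel (shadow b k k)" for b
  proof -
    have "ennreal k * (\<integral>\<^sup>+ y. ennreal \<bar>G y \<bullet> b\<bar> * indicator ?R y \<partial>lborel)
       \<le> ennreal (2 * k) * emeasure lborel (shadow b k k)"
      using assms by (intro dir_deriv_nn_integral_le F_nonneg borel_shadow) (auto simp: shadow_def)
    also have "ennreal (2 * k) = ennreal k * 2" using assms by (simp add: ennreal_mult mult.commute)
    finally show ?thesis using assms by (simp add: ennreal_mult_le_mult_iff mult.assoc)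
  qed
  have "ennreal (W y) * indicator ?R y
      \<le> ennreal c * (indicator ?R y + (\<Sum>b\<in>Basis. ennreal \<bar>G y \<bullet> b\<bar> * indicator ?R y))" for y
  proof -
    have "W y \<le> c * (1 + (\<Sum>b\<in>Basis. \<bar>G y \<bullet> b\<bar>))"
      using W_le_G[of y] norm_le_l1[of "G y"] c_pos
      by (smt (verit) mult_left_mono)
    then have "ennreal (W y) \<le> ennreal c * (1 + (\<Sum>b\<in>Basis. ennreal \<bar>G y \<bullet> b\<bar>))"
      using c_pos by (simp add: ennreal_mult'[symmetric] sum_ennreal sum_nonneg ennreal_leI flip: ennreal_1 ennreal_plus)
    then show ?thesis by (auto simp: indicator_def)
  qed
  then have "area 0 k \<le> (\<integral>\<^sup>+ y. ennreal c * (indicator ?R y + (\<Sum>b\<in>Basis. ennreal \<bar>G y \<bullet> b\<bar> * indicator ?R y)) \<partial>lborel)"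
    unfolding area_zero by (intro nn_integral_mono)
  also have "\<dots> = ennreal c * (emeasure lborel ?R + (\<Sum>b\<in>Basis. \<integral>\<^sup>+ y. ennreal \<bar>G y \<bullet> b\<bar> * indicator ?R y \<partial>lborel))"
    by (subst nn_integral_cmult, measurable, subst nn_integral_add, measurable, subst nn_integral_sum) simp_all
  also have "\<dots> \<le> ennreal c * (?S + (\<Sum>b\<in>Basis. 2 * emeasure lborel (shadow b k k)))"
  proof (intro mult_left_mono add_mono sum_mono dir)
    obtain b :: 'a where b: "b \<in> Basis" using nonempty_Basis by blast
    have "emeasure lborel ?R \<le> emeasure lborel (shadow b k k)"
      using sublevel_subset_shadow assms by (intro emeasure_mono) auto
    also have "\<dots> \<le> ?S" using b by (intro member_le_sum) auto
    finally show "emeasure lborel ?R \<le> ?S" .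
  qed simp
  also have "\<dots> = ennreal (3 * c) * ?S"
  proof -
    have "?S + 2 * ?S = 3 * ?S" using distrib_right[of 1 2 ?S] by simp
    then show ?thesis using c_pos by (simp add: sum_distrib_left[symmetric] ennreal_mult mult_ac)
  qed
  finally show ?thesis .
qed

text \<open>Lower counterpart at an arbitrary \<open>x\<close>: the directional derivative of the
  tilted function is at most \<open>(c + norm (G x)) * W y\<close>, where \<open>W_ge_1\<close>
  absorbs the constant part.\<close>

lemma area_ge:
  assumes "norm b = 1" "0 \<le> k" "0 \<le> T" and [measurable]: "Z \<in> sets borel"
    and Z: "\<And>y. y \<in> Z \<Longrightarrow> F (y + T *\<^sub>R b) - G x \<bullet> (y + T *\<^sub>R b) - (F x - G x \<bullet> x) > k \<and>
      (\<exists>s\<in>{0..T}. F (y + s *\<^sub>R b) - G x \<bullet> (y + s *\<^sub>R b) - (F x - G x \<bullet> x) \<le> k / 2)"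
  shows "ennreal (k / 2) * emeasure lborel Z \<le> ennreal (T * (c + norm (G x))) * area x k"
proof -
  interpret H: convex_C1 "\<lambda>y. F y - G x \<bullet> y - (F x - G x \<bullet> x)" "\<lambda>y. G y - G x" by (rule tilted)
  let ?R = "{y. F y - G x \<bullet> y - (F x - G x \<bullet> x) \<le> k}"
  have "ennreal (k / 2) * emeasure lborel Z
      \<le> ennreal T * (\<integral>\<^sup>+ y. ennreal \<bar>(G y - G x) \<bullet> b\<bar> * indicator ?R y \<partial>lborel)"
    using assms by (intro H.dir_deriv_nn_integral_ge) auto
  also have "(\<integral>\<^sup>+ y. ennreal \<bar>(G y - G x) \<bullet> b\<bar> * indicator ?R y \<partial>lborel)
      \<le> (\<integral>\<^sup>+ y. ennreal (c + norm (G x)) * (ennreal (W y) * indicator ?R y) \<partial>lborel)"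
  proof (rule nn_integral_mono)
    fix y
    have "\<bar>(G y - G x) \<bullet> b\<bar> \<le> norm (G y - G x) * norm b" by (rule Cauchy_Schwarz_ineq2)
    also have "\<dots> \<le> norm (G y) + norm (G x)" using norm_triangle_ineq4 assms(1) by simp
    also have "\<dots> \<le> c * W y + norm (G x) * W y"
      using G_le_W[of y] W_ge_1[of y] by (intro add_mono) (auto simp: mult_le_cancel_left1)
    finally have "ennreal \<bar>(G y - G x) \<bullet> b\<bar> \<le> ennreal ((c + norm (G x)) * W y)"
      by (intro ennreal_leI) (simp add: distrib_right)
    also have "\<dots> = ennreal (c + norm (G x)) * ennreal (W y)"
      using c_pos W_ge_1[of y] by (intro ennreal_mult) auto
    finally show "ennreal \<bar>(G y - G x) \<bullet> b\<bar> * indicator ?R y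
       \<le> ennreal (c + norm (G x)) * (ennreal (W y) * indicator ?R y)"
      by (auto simp: indicator_def)
  qed
  also have "\<dots> = ennreal (c + norm (G x)) * area x k"
    unfolding area_def section_eq by (rule nn_integral_cmult) (auto simp: section_eq[symmetric])
  finally show ?thesis using c_pos \<open>0 \<le> T\<close> by (simp add: ennreal_mult mult.assoc mult_left_mono)
qed

lemma \<eta>_polynomial_bound:
  obtains C where "\<And>k. k \<ge> 1 \<Longrightarrow> \<eta> k \<le> C * k ^ DIM('a)"
proof -
  obtain a where a: "a > 0" "\<And>y. F y \<ge> a * norm y - 1" using linear_growth[OF finite_sublevel] by blast
  \<comment> \<open>For \<open>k \<ge> 1\<close>, points with \<open>F \<le> k\<close> have norm at
    most \<open>(k + 1) / a \<le> 2 * k / a\<close>, and the displacement along a unit vector within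
    a shadow adds at most \<open>k\<close>.\<close>
  define \<rho> where "\<rho> = 2 / a + 1"
  define C where "C = 3 * c * (real DIM('a) * (unit_ball_vol (real DIM('a)) * \<rho> ^ DIM('a)))"
  have "\<rho> > 0" using a(1) unfolding \<rho>_def by (simp add: add_pos_pos)
  have "\<eta> k \<le> C * k ^ DIM('a)" if k: "k \<ge> 1" for k
  proof -
    have sub: "shadow b k k \<subseteq> cball 0 (\<rho> * k)" if b: "b \<in> Basis" for b
    proof
      fix y assume "y \<in> shadow b k k"
      then obtain t where t: "t \<in> {0..k}" "F (y + t *\<^sub>R b) \<le> k" unfolding shadow_def by blast
      have "a * norm (y + t *\<^sub>R b) \<le> 2 * k" using a(2)[of "y + t *\<^sub>R b"] t k by linarith
      then have "norm (y + t *\<^sub>R b) \<le> 2 * k / a" using a(1) by (simp add: field_simps)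
      moreover have "norm y \<le> norm (y + t *\<^sub>R b) + norm (t *\<^sub>R b)"
        by (metis add_diff_cancel_right' norm_triangle_ineq4)
      moreover have "norm (t *\<^sub>R b) \<le> k" using t b by simp
      ultimately show "y \<in> cball 0 (\<rho> * k)" by (simp add: \<rho>_def algebra_simps)
    qed
    have "ennreal (\<eta> k) \<le> ennreal (W 0 * \<eta> k)"
      using W_ge_1[of 0] \<eta>_nonneg[of k] k by (intro ennreal_leI) (auto simp: mult_le_cancel_right1)
    also have "\<dots> = area 0 k" using k by (simp add: area)
    also have "\<dots> \<le> ennreal (3 * c) * (\<Sum>b\<in>Basis. emeasure lborel (shadow b k k))"
      using k by (intro area_zero_le) auto
    also have "\<dots> \<le> ennreal (3 * c) * (\<Sum>b\<in>(Basis::'a set). emeasure lborel (cball (0::'a) (\<rho> * k)))"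
      using sub by (intro mult_left_mono sum_mono emeasure_mono) auto
    also have "\<dots> = ennreal (C * k ^ DIM('a))"
      using \<open>\<rho> > 0\<close> k c_pos by (simp add: emeasure_cball C_def ennreal_mult' power_mult_distrib
         ennreal_of_nat_eq_real_of_nat flip: ennreal_mult')
    finally show ?thesis
      using k c_pos \<open>\<rho> > 0\<close> unfolding C_def by (subst (asm) ennreal_le_iff) auto
  qed
  then show ?thesis by (rule that)
qed

end

section \<open>Superlinear growth\<close>

context section_area
begin

lemma \<eta>_pos:
  assumes "k > 0"
  shows "\<eta> k > 0"
proof (rule ccontr)
  assume "\<not> \<eta> k > 0"
  then have "\<eta> k = 0" using \<eta>_nonneg[OF assms] by simp
  then have "area 0 k = 0" using assms by (simp add: area)
  then show False
    using sublevel_emeasure_pos[OF assms] emeasure_section_le_area[of 0 k] by (simp add: G_zero F_zero)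
qed

lemma area_le_imp_\<eta>_le:
  assumes "area x k \<le> area 0 k'" "k > 0" "k' > 0"
  shows "W x * \<eta> k \<le> W 0 * \<eta> k'"
  using assms W_ge_1[of 0] \<eta>_nonneg[of k'] by (simp add: area ennreal_le_iff)

text \<open>If \<open>W\<close> were bounded by \<open>W 0\<close>, the gradient would be bounded,
  and \<open>F y \<le> G y \<bullet> y\<close> would allow only linear growth.\<close>

lemma superlinear_W_unbounded:
  assumes superlinear: "\<And>a. \<exists>b. \<forall>y. a * norm y - b \<le> F y"
  obtains x where "W x > W 0"
proof (rule ccontr)
  assume "\<not> thesis"
  with that have W: "W x \<le> W 0" for x by (meson not_le)
  have G: "norm (G x) \<le> c * W 0" for x
    using G_le_W[of x] W[of x] c_pos by (meson mult_left_mono order_trans less_imp_le)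
  obtain b where b: "\<And>y. (c * W 0 + 1) * norm y - b \<le> F y" using superlinear by blast
  obtain e :: 'a where e: "e \<in> Basis" using nonempty_Basis by blast
  define y where "y = (\<bar>b\<bar> + 1) *\<^sub>R e"
  have y: "norm y = \<bar>b\<bar> + 1" using e by (simp add: y_def)
  have "F y \<le> G y \<bullet> y" using tangent_le[of y 0] F_zero by simp
  also have "\<dots> \<le> c * W 0 * norm y"
    using norm_cauchy_schwarz[of "G y" y] G[of y] by (meson mult_right_mono norm_ge_zero order_trans)
  finally show False using b[of y] y by (simp add: algebra_simps)
qed

lemma not_superlinear:
  assumes superlinear: "\<And>a. \<exists>b. \<forall>y. a * norm y - b \<le> F y"
  shows False
proof -
  obtain x where x: "W x > W 0" using superlinear_W_unbounded[OF superlinear] .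
  define q where "q = W x / W 0"
  have W0: "W 0 > 0" using W_ge_1[of 0] by linarith
  then have q: "q > 1" using x by (simp add: q_def)
  have step: "\<exists>k1\<ge>1. \<forall>k\<ge>k1. q * \<eta> k \<le> \<eta> (r * k)" if "r > 1" for r
  proof -
    \<comment> \<open>This makes \<open>(1 - \<epsilon>) * r = 1 + (r - 1) / 2\<close>. The slope
      \<open>norm (G x) / \<epsilon>\<close> bounds \<open>G x \<bullet> y\<close> by
      \<open>\<epsilon> * F y\<close> plus a constant, and for large \<open>k\<close> the surplus
      \<open>(r - 1) / 2 * k\<close> covers the constants collected in \<open>K\<close>.\<close>
    define \<epsilon> where "\<epsilon> = (r - 1) / (2 * r)"
    have \<epsilon>: "\<epsilon> > 0" "1 - \<epsilon> = (r + 1) / (2 * r)" using that by (auto simp: \<epsilon>_def field_simps)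
    obtain b where b: "\<And>y. norm (G x) / \<epsilon> * norm y - b \<le> F y" using superlinear by blast
    define K where "K = \<bar>F x - G x \<bullet> x\<bar> + \<epsilon> * \<bar>b\<bar>"
    have "q * \<eta> k \<le> \<eta> (r * k)" if k: "k \<ge> 1" "k \<ge> 2 * K / (r - 1)" for k
    proof -
      have sub: "F y \<le> r * k" if y: "F y \<le> F x + G x \<bullet> (y - x) + k" for y
      proof -
        have "norm (G x) * norm y \<le> \<epsilon> * (F y + b)" using b[of y] \<epsilon>(1) by (simp add: field_simps)
        moreover have "\<epsilon> * b \<le> \<epsilon> * \<bar>b\<bar>" using \<epsilon>(1) by (intro mult_left_mono) auto
        ultimately have "G x \<bullet> y \<le> \<epsilon> * F y + \<epsilon> * \<bar>b\<bar>"
          using norm_cauchy_schwarz[of "G x" y] by (simp add: distrib_left)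
        then have "(1 - \<epsilon>) * F y \<le> k + K" using y by (simp add: K_def inner_diff_right algebra_simps)
        also have "\<dots> \<le> k + k * (r - 1) / 2" using k(2) \<open>r > 1\<close> by (simp add: field_simps)
        also have "\<dots> = (1 - \<epsilon>) * (r * k)" using \<open>r > 1\<close> unfolding \<epsilon>(2) by (simp add: field_simps)
        finally have "(1 - \<epsilon>) * F y \<le> (1 - \<epsilon>) * (r * k)" .
        moreover have "1 - \<epsilon> > 0" using \<open>r > 1\<close> unfolding \<epsilon>(2) by simp
        ultimately show ?thesis by (rule mult_left_le_imp_le)
      qed
      have "area x k \<le> area 0 (r * k)"
        unfolding area_zero unfolding area_def
        using sub by (intro nn_integral_mono) (auto simp: indicator_def)
      then have "W x * \<eta> k \<le> W 0 * \<eta> (r * k)"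
        using k \<open>r > 1\<close> by (intro area_le_imp_\<eta>_le) auto
      then show ?thesis using W0 by (simp add: q_def field_simps)
    qed
    then show ?thesis by (intro exI[of _ "max 1 (2 * K / (r - 1))"]) auto
  qed
  define n where "n = DIM('a)"
  \<comment> \<open>Then \<open>r ^ n\<close> is the square root of \<open>q\<close>: each iteration
    gains a factor \<open>q\<close>, while the polynomial bound permits only
    \<open>r ^ n\<close>.\<close>
  define r where "r = q powr (1 / (2 * real n))"
  have n: "n > 0" by (simp add: n_def)
  have r1: "r > 1" unfolding r_def using q n by simp
  have "r ^ n = r powr real n" using r1 by (simp add: powr_realpow)
  also have "\<dots> = q powr (1/2)" using n by (simp add: r_def powr_powr)
  also have "\<dots> < q powr 1" using q by (intro powr_less_mono) auto
  finally have rq: "r ^ n < q" using q by simp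
  obtain k1 where k1: "k1 \<ge> 1" "\<And>k. k \<ge> k1 \<Longrightarrow> q * \<eta> k \<le> \<eta> (r * k)" using step[OF r1] by blast
  obtain C where C: "\<And>k. k \<ge> 1 \<Longrightarrow> \<eta> k \<le> C * k ^ n" unfolding n_def using \<eta>_polynomial_bound by blast
  have ge: "k1 \<le> r ^ j * k1" for j
    using r1 k1(1) one_le_power[of r j] by (simp add: mult_le_cancel_right1)
  have iter: "q ^ j * \<eta> k1 \<le> \<eta> (r ^ j * k1)" for j
  proof (induction j)
    case (Suc j)
    have "q ^ Suc j * \<eta> k1 \<le> q * \<eta> (r ^ j * k1)" using Suc q by (simp add: mult.assoc)
    also have "\<dots> \<le> \<eta> (r * (r ^ j * k1))" by (intro k1(2) ge)
    finally show ?case by (simp add: mult.assoc)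
  qed simp
  have pos: "\<eta> k1 > 0" using k1 by (intro \<eta>_pos) auto
  have "1 < q / r ^ n" using rq r1 by simp
  then obtain j where "C * k1 ^ n / \<eta> k1 < (q / r ^ n) ^ j" using real_arch_pow by blast
  then have "C * k1 ^ n * (r ^ n) ^ j < q ^ j * \<eta> k1"
    using pos r1 by (simp add: power_divide field_simps)
  also have "\<dots> \<le> C * (r ^ j * k1) ^ n"
    using iter[of j] C[of "r ^ j * k1"] ge[of j] k1(1) by linarith
  finally show False by (simp add: power_mult_distrib mult_ac flip: power_mult)
qed

end

section \<open>A direction of linear growth\<close>

text \<open>\<open>\<theta>\<close> is to be the supremum of the slopes of linear lower bounds;
  \<open>growth\<close> takes half of it because the supremum itself need not be attained.\<close>

locale slow_direction = section_area F G W c \<eta>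
  for F :: "'a::euclidean_space \<Rightarrow> real" and G W c \<eta> +
  fixes v :: 'a and \<theta> B0 :: real
  assumes norm_v: "norm v = 1" and \<theta>_pos: "\<theta> > 0"
    and slope_le: "\<And>y s. s \<ge> 0 \<Longrightarrow> F (y + s *\<^sub>R v) \<le> F y + s * \<theta>"
    and growth: "\<And>y. \<theta> / 2 * norm y - B0 \<le> F y"
begin

text \<open>Here \<open>x\<close> minimises \<open>F\<close> tilted by the slope \<open>(1 - \<delta>)\<theta>\<close> in the direction \<open>v\<close>;
  the sections at such points have length of order \<open>k / \<delta>\<close>.\<close>
definition near_slow :: "real \<Rightarrow> 'a \<Rightarrow> real \<Rightarrow> bool" where
  "near_slow \<delta> x B \<longleftrightarrow> G x = ((1 - \<delta>) * \<theta>) *\<^sub>R v \<and>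
     (\<forall>y. F x - G x \<bullet> x \<le> F y - G x \<bullet> y) \<and> (\<forall>y. \<delta> * \<theta> / 2 * norm y - B \<le> F y - G x \<bullet> y)"

lemma norm_sublevel_le:
  assumes "F a \<le> k / 24" "k \<ge> 24 * B0"
  shows "norm a \<le> k / (6 * \<theta>)"
  using growth[of a] assms \<theta>_pos by (simp add: field_simps)

lemma width_less:
  assumes "k > 0"
  shows "k / (6 * \<theta>) + k / (6 * \<theta>) + k < (1 / \<theta> + 2) * k"
proof -
  have "k / \<theta> > 0" using assms \<theta>_pos by simp
  moreover have "k / (6 * \<theta>) = (k / \<theta>) / 6" by simp
  moreover have "(1 / \<theta> + 2) * k = k / \<theta> + 2 * k" by (simp add: distrib_right)
  ultimately show ?thesis using assms by linarith
qed

text \<open>Moving by \<open>s\<close> along \<open>v\<close> raises \<open>F\<close> by at most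
  \<open>s * \<theta>\<close>, while the linear part removes
  \<open>(1 - \<delta>) * s * \<theta>\<close>, so the net rise is at most
  \<open>\<delta> * s * \<theta> \<le> k / 8\<close>. With \<open>k / 24\<close> for
  \<open>F a\<close>, \<open>k / 6\<close> for \<open>G x \<bullet> a\<close> and
  \<open>k / 8\<close> for the offset at \<open>x\<close>, the total is
  \<open>11 / 24 * k\<close>.\<close>

lemma section_contains_cylinder:
  assumes x: "near_slow \<delta> x B" and \<delta>: "0 < \<delta>" "\<delta> < 1" and a: "F a \<le> k / 24"
    and k: "k \<ge> 24 * B0" "k \<ge> 8 * (G x \<bullet> x - F x)" "k \<ge> 0"
    and s: "0 \<le> s" "s \<le> k / (8 * \<delta> * \<theta>)"
  shows "F (a + s *\<^sub>R v) - G x \<bullet> (a + s *\<^sub>R v) - (F x - G x \<bullet> x) \<le> k / 2"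
proof -
  have "\<bar>v \<bullet> a\<bar> \<le> norm a" using Cauchy_Schwarz_ineq2[of v a] norm_v by simp
  then have "\<bar>(1 - \<delta>) * \<theta> * (v \<bullet> a)\<bar> \<le> 1 * \<theta> * norm a"
    unfolding abs_mult using \<delta> \<theta>_pos by (intro mult_mono) auto
  also have "\<dots> \<le> k / 6" using norm_sublevel_le[OF a k(1)] \<theta>_pos by (simp add: field_simps)
  finally have "\<bar>(1 - \<delta>) * \<theta> * (v \<bullet> a)\<bar> \<le> k / 6" .
  moreover define q where "q = (1 - \<delta>) * \<theta> * (v \<bullet> a)"
  ultimately have 1: "- q \<le> k / 6" by linarith
  define d e where "d = s * \<theta> * \<delta>" and "e = s * \<theta>"
  have "d \<le> k / 8" unfolding d_def using s(2) \<delta> \<theta>_pos by (simp add: field_simps)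
  moreover have "G x \<bullet> (a + s *\<^sub>R v) = q + (e - d)"
  proof -
    have Gx: "G x = ((1 - \<delta>) * \<theta>) *\<^sub>R v" using x by (simp add: near_slow_def)
    show ?thesis using norm_v unfolding Gx q_def d_def e_def by (simp add: inner_simps algebra_simps norm_eq_1)
  qed
  ultimately have "F (a + s *\<^sub>R v) - G x \<bullet> (a + s *\<^sub>R v) \<le> F a - q + d"
    using slope_le[OF s(1), of a, folded e_def] by linarith
  also have "\<dots> \<le> k / 24 + k / 6 + k / 8" using a 1 \<open>d \<le> k / 8\<close> by linarith
  finally have "F (a + s *\<^sub>R v) - G x \<bullet> (a + s *\<^sub>R v) \<le> 8 / 24 * k" by simp
  moreover have "G x \<bullet> x - F x \<le> 3 / 24 * k" using k(2) by simp
  moreover have "8 / 24 * k + 3 / 24 * k \<le> k / 2" using k(3) by simp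
  ultimately show ?thesis by simp
qed

text \<open>At this distance the growth bound in \<open>near_slow\<close> gives at least
  \<open>2 * k - B\<close>, which exceeds \<open>k\<close>. The offset at \<open>x\<close> is at
  most 0, as the minimum does not exceed the value at the origin.\<close>

lemma far_outside_section:
  assumes x: "near_slow \<delta> x B" and \<delta>: "0 < \<delta>" and y: "norm y \<ge> 4 * k / (\<delta> * \<theta>)" and k: "k > B"
  shows "F y - G x \<bullet> y - (F x - G x \<bullet> x) > k"
proof -
  have "2 * k \<le> \<delta> * \<theta> / 2 * norm y" using y \<delta> \<theta>_pos by (simp add: field_simps)
  moreover have "\<delta> * \<theta> / 2 * norm y - B \<le> F y - G x \<bullet> y" "F x - G x \<bullet> x \<le> 0"
    using x F_zero unfolding near_slow_def by (auto dest: spec[of _ 0])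
  ultimately show ?thesis using k by linarith
qed

text \<open>For \<open>b\<close> parallel to \<open>v\<close>, passing to the shadow lengthens the
  sublevel set along \<open>v\<close> by at most \<open>k\<close>. So \<open>N\<close> translates of
  the shadow along \<open>v\<close> fit into the cylinder, and volume alone gives the bound.\<close>

lemma area_ge_parallel:
  assumes x: "near_slow \<delta> x B" and \<delta>: "0 < \<delta>" "\<delta> < 1"
    and k: "k \<ge> 24 * B0" "k \<ge> 8 * (G x \<bullet> x - F x)" "k > 0"
    and b: "b = v \<or> b = - v" and N: "real N * (1 / \<theta> + 2) \<le> 1 / (8 * \<delta> * \<theta>)"
  shows "of_nat N * emeasure lborel (shadow b k (k / 24)) \<le> area x k"
proof -
  define \<sigma> where "\<sigma> = (1 / \<theta> + 2) * k"
  have \<sigma>: "\<sigma> \<ge> 2 * k" using \<theta>_pos k(3) by (simp add: \<sigma>_def distrib_right)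
  have N\<sigma>: "real N * \<sigma> \<le> k / (8 * \<delta> * \<theta>)"
    using mult_right_mono[OF N, of k] k(3) by (simp add: \<sigma>_def algebra_simps)
  have nb: "norm b = 1" using b norm_v by auto
  have "of_nat N * emeasure lborel (shadow b k (k / 24))
     \<le> emeasure lborel {y. F y \<le> F x + G x \<bullet> (y - x) + k}"
  proof (rule emeasure_disjoint_translates_le[where l=v and w="\<sigma> *\<^sub>R v" and c="k *\<^sub>R v"])
    fix y z assume "y \<in> shadow b k (k / 24)" "z \<in> shadow b k (k / 24)"
    then obtain t t' where t: "t \<in> {0..k}" "F (y + t *\<^sub>R b) \<le> k / 24"
      and t': "t' \<in> {0..k}" "F (z + t' *\<^sub>R b) \<le> k / 24" unfolding shadow_def by blast
    have "v \<bullet> (y - z) = v \<bullet> ((y + t *\<^sub>R b) - (z + t' *\<^sub>R b)) + (t' - t) * (v \<bullet> b)"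
      by (simp add: inner_simps algebra_simps)
    moreover have "v \<bullet> ((y + t *\<^sub>R b) - (z + t' *\<^sub>R b)) \<le> norm (y + t *\<^sub>R b) + norm (z + t' *\<^sub>R b)"
      using norm_cauchy_schwarz[of v "(y + t *\<^sub>R b) - (z + t' *\<^sub>R b)"] norm_v
        norm_triangle_ineq4[of "y + t *\<^sub>R b" "z + t' *\<^sub>R b"] by simp
    moreover have "norm (y + t *\<^sub>R b) \<le> k / (6 * \<theta>)" "norm (z + t' *\<^sub>R b) \<le> k / (6 * \<theta>)"
      using t t' k(1) by (auto intro: norm_sublevel_le)
    moreover have "(t' - t) * (v \<bullet> b) \<le> k"
      using b t t' norm_v by (auto simp: norm_eq_1)
    ultimately have "v \<bullet> (y - z) \<le> k / (6 * \<theta>) + k / (6 * \<theta>) + k" by linarith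
    also have "\<dots> < \<sigma>" unfolding \<sigma>_def by (rule width_less[OF k(3)])
    finally show "v \<bullet> (y - z) < v \<bullet> \<sigma> *\<^sub>R v" using norm_v by (simp add: norm_eq_1)
  next
    fix y j assume y: "y \<in> shadow b k (k / 24)" "j < N"
    then obtain t where t: "t \<in> {0..k}" "F (y + t *\<^sub>R b) \<le> k / 24" unfolding shadow_def by blast
    \<comment> \<open>The offset \<open>k *\<^sub>R v\<close> of the translates compensates the
      displacement \<open>t *\<^sub>R b\<close> and keeps \<open>s\<close> nonnegative for either
      sign of \<open>b\<close>.\<close>
    define s where "s = k + real j * \<sigma> - t * (v \<bullet> b)"
    have vb: "(v \<bullet> b) *\<^sub>R v = b" "\<bar>v \<bullet> b\<bar> \<le> 1" using b norm_v by (auto simp: norm_eq_1)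
    have "\<bar>t * (v \<bullet> b)\<bar> \<le> k * 1" unfolding abs_mult using t vb by (intro mult_mono) auto
    moreover have "0 \<le> real j * \<sigma>" using \<sigma> k(3) by simp
    ultimately have s: "0 \<le> s" "s \<le> real j * \<sigma> + 2 * k"
      using k(3) unfolding s_def by linarith+
    have "real j * \<sigma> + \<sigma> \<le> real N * \<sigma>"
      using y(2) \<sigma> k(3) mult_right_mono[of "real j + 1" "real N" \<sigma>] by (simp add: distrib_right)
    then have "s \<le> k / (8 * \<delta> * \<theta>)" using s N\<sigma> \<sigma> by linarith
    then have "F (y + t *\<^sub>R b + s *\<^sub>R v) - G x \<bullet> (y + t *\<^sub>R b + s *\<^sub>R v) - (F x - G x \<bullet> x) \<le> k / 2"
      using x \<delta> t k s by (intro section_contains_cylinder) auto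
    moreover have "y + t *\<^sub>R b + s *\<^sub>R v = y + (k *\<^sub>R v + real j *\<^sub>R \<sigma> *\<^sub>R v)"
    proof -
      have "s *\<^sub>R v = k *\<^sub>R v + (real j * \<sigma>) *\<^sub>R v - t *\<^sub>R ((v \<bullet> b) *\<^sub>R v)"
        by (simp add: s_def scaleR_diff_left scaleR_add_left)
      then show ?thesis unfolding vb(1) by simp
    qed
    ultimately show "y + (k *\<^sub>R v + real j *\<^sub>R \<sigma> *\<^sub>R v) \<in> {y. F y \<le> F x + G x \<bullet> (y - x) + k}"
      unfolding section_eq using k(3) by (simp only: mem_Collect_eq)
  qed auto
  also have "\<dots> \<le> area x k" by (rule emeasure_section_le_area)
  finally show ?thesis .
qed

text \<open>Translates along \<open>v\<close> produce the factor \<open>N\<close>. Translates along \<open>-b\<close> only convert the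
  bound of \<open>area_ge\<close>, which loses a factor \<open>T / k\<close>, into a bound by the shadow itself.\<close>
lemma area_ge_transversal:
  assumes x: "near_slow \<delta> x B" and \<delta>: "0 < \<delta>" "\<delta> < 1"
    and k: "k \<ge> 24 * B0" "k \<ge> 8 * (G x \<bullet> x - F x)" "k > 0" "k > B"
    and b: "norm b = 1" and \<kappa>: "\<kappa> * (1 - (v \<bullet> b)\<^sup>2) = 1 / \<theta> + 2" "\<kappa> > 0"
    and N: "real N * \<kappa> \<le> 1 / (8 * \<delta> * \<theta>)"
  shows "of_nat N * emeasure lborel (shadow b k (k / 24)) \<le> ennreal (4 * (1 + \<kappa>) * (c + \<theta>)) * area x k"
proof -
  define \<sigma> where "\<sigma> = \<kappa> * k"
  define L where "L = k / (8 * \<delta> * \<theta>)"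
  define \<beta> where "\<beta> = 1 - (v \<bullet> b)\<^sup>2"
  have \<sigma>: "\<sigma> > 0" using \<kappa> k(3) by (simp add: \<sigma>_def)
  have L: "L > 0" using \<delta> \<theta>_pos k(3) by (simp add: L_def)
  have \<sigma>\<beta>: "\<sigma> * \<beta> = (1 / \<theta> + 2) * k" unfolding \<kappa>(1)[symmetric] by (simp add: \<sigma>_def \<beta>_def mult_ac)
  have N\<sigma>: "real N * \<sigma> \<le> L"
    using mult_right_mono[OF N, of k] k(3) by (simp add: \<sigma>_def L_def algebra_simps)
  have vv: "v \<bullet> v = 1" and bb: "b \<bullet> b = 1" using norm_v b by (simp_all add: norm_eq_1)
  have \<beta>1: "\<beta> \<le> 1" by (simp add: \<beta>_def)
  \<comment> \<open>\<open>u\<close> is orthogonal to \<open>b\<close>, so the length of a shadow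
    along \<open>b\<close> does not count in the functional \<open>u\<close>; likewise
    \<open>w\<close> is orthogonal to \<open>v\<close> and ignores the length of the
    cylinder.\<close>
  define u where "u = v - (v \<bullet> b) *\<^sub>R b"
  define w where "w = b - (v \<bullet> b) *\<^sub>R v"
  have u: "u \<bullet> b = 0" "u \<bullet> v = \<beta>" "u \<bullet> u = \<beta>" and w: "w \<bullet> v = 0" "w \<bullet> b = \<beta>" "w \<bullet> w = \<beta>"
    using vv bb by (simp_all add: u_def w_def \<beta>_def inner_simps inner_commute power2_eq_square algebra_simps)
  have nu: "norm u \<le> 1" "norm w \<le> 1" using u(3) w(3) \<beta>1 by (simp_all add: norm_eq_sqrt_inner)
  have small: "l \<bullet> (a - a') \<le> k / (3 * \<theta>)"
    if "F a \<le> k / 24" "F a' \<le> k / 24" "norm l \<le> 1" for a a' l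
  proof -
    have "l \<bullet> (a - a') \<le> norm l * norm (a - a')" by (rule norm_cauchy_schwarz)
    also have "\<dots> \<le> 1 * (norm a + norm a')" using that by (intro mult_mono norm_triangle_ineq4) auto
    also have "\<dots> \<le> k / (6 * \<theta>) + k / (6 * \<theta>)"
      using norm_sublevel_le[OF that(1) k(1)] norm_sublevel_le[OF that(2) k(1)] by simp
    finally show ?thesis by simp
  qed
  have lt: "k / (3 * \<theta>) + k < \<sigma> * \<beta>" using width_less[OF k(3)] unfolding \<sigma>\<beta> by simp
  \<comment> \<open>The total shift \<open>N2 * \<sigma>\<close> has to reach the sum of the length
    \<open>L\<close> of the cylinder, the radius of the sublevel set and the distance at which
    points leave the section.\<close>
  obtain N2 :: nat where N2: "N2 \<ge> 1" "1 / (8 * \<delta> * \<theta>) + 1 / (6 * \<theta>) + 4 / (\<delta> * \<theta>) \<le> real N2 * \<kappa>"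
  proof -
    obtain m :: nat where "1 / (8 * \<delta> * \<theta>) + 1 / (6 * \<theta>) + 4 / (\<delta> * \<theta>) < real m * \<kappa>"
      using reals_Archimedean3[OF \<kappa>(2)] by blast
    also have "\<dots> \<le> real (Suc m) * \<kappa>" using \<kappa>(2) by (intro mult_right_mono) auto
    finally show ?thesis by (intro that[of "Suc m"]) auto
  qed
  have N2\<sigma>: "L + k / (6 * \<theta>) + 4 * k / (\<delta> * \<theta>) \<le> real N2 * \<sigma>"
    using mult_right_mono[OF N2(2), of k] k(3) by (simp add: \<sigma>_def L_def distrib_right mult.assoc)
  \<comment> \<open>\<open>Q T\<close> is the shadow of length \<open>T\<close> along
    \<open>b\<close> of the whole cylinder of length \<open>L\<close> over the small sublevel
    set.\<close>
  define Q where "Q T = {y. \<exists>t\<in>{0..T}. \<exists>s\<in>{0..L}. F (y + t *\<^sub>R b - s *\<^sub>R v) \<le> k / 24}" for T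
  have [measurable]: "Q T \<in> sets borel" for T
  proof -
    have "Q T = {y + z |y z. y \<in> shadow b T (k / 24) \<and> z \<in> (\<lambda>s. s *\<^sub>R v) ` {0..L}}"
    proof (intro set_eqI iffI)
      fix y assume "y \<in> Q T"
      then obtain t s where "t \<in> {0..T}" "s \<in> {0..L}" "F (y + t *\<^sub>R b - s *\<^sub>R v) \<le> k / 24"
        unfolding Q_def by blast
      then show "y \<in> {y + z |y z. y \<in> shadow b T (k / 24) \<and> z \<in> (\<lambda>s. s *\<^sub>R v) ` {0..L}}"
        unfolding shadow_def
        by (intro CollectI exI[of _ "y - s *\<^sub>R v"] exI[of _ "s *\<^sub>R v"]) (auto simp: algebra_simps)
    next
      fix y assume "y \<in> {y + z |y z. y \<in> shadow b T (k / 24) \<and> z \<in> (\<lambda>s. s *\<^sub>R v) ` {0..L}}"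
      then show "y \<in> Q T" unfolding Q_def shadow_def by (force simp: algebra_simps)
    qed
    moreover have "compact \<dots>"
      by (intro compact_sums compact_shadow compact_continuous_image continuous_intros) auto
    ultimately show ?thesis by (simp add: borel_compact)
  qed
  have 1: "of_nat N * emeasure lborel (shadow b k (k / 24)) \<le> emeasure lborel (Q k)"
  proof (rule emeasure_disjoint_translates_le[where l=u and w="\<sigma> *\<^sub>R v" and c=0])
    fix y z assume "y \<in> shadow b k (k / 24)" "z \<in> shadow b k (k / 24)"
    then obtain t t' where t: "t \<in> {0..k}" "F (y + t *\<^sub>R b) \<le> k / 24"
      and t': "t' \<in> {0..k}" "F (z + t' *\<^sub>R b) \<le> k / 24" unfolding shadow_def by blast
    have "u \<bullet> (y - z) = u \<bullet> ((y + t *\<^sub>R b) - (z + t' *\<^sub>R b))"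
      using u(1) by (simp add: inner_simps)
    also have "\<dots> \<le> k / (3 * \<theta>)" using t t' nu by (intro small) auto
    finally show "u \<bullet> (y - z) < u \<bullet> \<sigma> *\<^sub>R v" using lt k(3) u(2) by simp
  next
    fix y j assume y: "y \<in> shadow b k (k / 24)" "j < N"
    then obtain t where t: "t \<in> {0..k}" "F (y + t *\<^sub>R b) \<le> k / 24" unfolding shadow_def by blast
    have "real j * \<sigma> \<le> real N * \<sigma>" using y(2) \<sigma> by (intro mult_right_mono) auto
    then have "real j * \<sigma> \<le> L" using N\<sigma> by linarith
    then have "real j * \<sigma> \<in> {0..L}" using \<sigma> by simp
    with t show "y + (0 + real j *\<^sub>R \<sigma> *\<^sub>R v) \<in> Q k"
      unfolding Q_def by (intro CollectI bexI[of _ t] bexI[of _ "real j * \<sigma>"]) (auto simp: algebra_simps)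
  qed auto
  define T where "T = k + real N2 * \<sigma>"
  have T: "T > 0" using k(3) \<sigma> by (simp add: T_def add_pos_nonneg)
  have 2: "of_nat N2 * emeasure lborel (Q k) \<le> emeasure lborel (Q T)"
  proof (rule emeasure_disjoint_translates_le[where l="- w" and w="(- \<sigma>) *\<^sub>R b" and c=0])
    fix y z assume "y \<in> Q k" "z \<in> Q k"
    then obtain t t' s s' where t: "t \<in> {0..k}" "F (y + t *\<^sub>R b - s *\<^sub>R v) \<le> k / 24"
      and t': "t' \<in> {0..k}" "F (z + t' *\<^sub>R b - s' *\<^sub>R v) \<le> k / 24" unfolding Q_def by blast
    have "(- w) \<bullet> (y - z) = (- w) \<bullet> ((y + t *\<^sub>R b - s *\<^sub>R v) - (z + t' *\<^sub>R b - s' *\<^sub>R v)) + (t - t') * \<beta>"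
      using w by (simp add: inner_simps algebra_simps)
    moreover have "(t - t') * \<beta> \<le> k"
    proof -
      have "0 < k / (3 * \<theta>) + k" using k(3) \<theta>_pos by (intro add_pos_pos) auto
      then have "0 < \<sigma> * \<beta>" using lt by linarith
      then have "\<beta> > 0" using \<sigma> by (simp add: zero_less_mult_iff)
      then have "(t - t') * \<beta> \<le> k * 1" using t t' \<beta>1 k(3) by (intro mult_mono) auto
      then show ?thesis by simp
    qed
    moreover have "(- w) \<bullet> ((y + t *\<^sub>R b - s *\<^sub>R v) - (z + t' *\<^sub>R b - s' *\<^sub>R v)) \<le> k / (3 * \<theta>)"
      using t t' nu by (intro small) auto
    moreover have "(- w) \<bullet> ((- \<sigma>) *\<^sub>R b) = \<sigma> * \<beta>" using w(2) by simp
    ultimately show "(- w) \<bullet> (y - z) < (- w) \<bullet> ((- \<sigma>) *\<^sub>R b)" using lt by linarith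
  next
    fix y j assume y: "y \<in> Q k" "j < N2"
    then obtain t s where t: "t \<in> {0..k}" "s \<in> {0..L}" "F (y + t *\<^sub>R b - s *\<^sub>R v) \<le> k / 24"
      unfolding Q_def by blast
    have "real j * \<sigma> \<le> real N2 * \<sigma>" using y(2) \<sigma> by (intro mult_right_mono) auto
    then have "t + real j * \<sigma> \<le> T" using t(1) unfolding T_def by (intro add_mono) auto
    then have "t + real j * \<sigma> \<in> {0..T}" using t(1) \<sigma> by simp
    with t show "y + (0 + real j *\<^sub>R (- \<sigma>) *\<^sub>R b) \<in> Q T"
      unfolding Q_def by (intro CollectI bexI[of _ "t + real j * \<sigma>"] bexI[of _ s]) (auto simp: algebra_simps)
  qed auto
  \<comment> \<open>Segments of length \<open>2 * T\<close> are used: from a start in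
    \<open>Q T\<close> they reach the cylinder within \<open>T\<close>, and the remaining length, at
    least \<open>T\<close>, carries them out of the section.\<close>
  have 3: "ennreal (k / 2) * emeasure lborel (Q T) \<le> ennreal (2 * T * (c + norm (G x))) * area x k"
  proof (rule area_ge)
    fix y assume "y \<in> Q T"
    then obtain t s where t: "t \<in> {0..T}" "s \<in> {0..L}" "F (y + t *\<^sub>R b - s *\<^sub>R v) \<le> k / 24"
      unfolding Q_def by blast
    define a where "a = y + t *\<^sub>R b - s *\<^sub>R v"
    have "F (a + s *\<^sub>R v) - G x \<bullet> (a + s *\<^sub>R v) - (F x - G x \<bullet> x) \<le> k / 2"
      using x \<delta> k t unfolding a_def L_def by (intro section_contains_cylinder) auto
    then have in_half: "\<exists>s\<in>{0..2 * T}. F (y + s *\<^sub>R b) - G x \<bullet> (y + s *\<^sub>R b) - (F x - G x \<bullet> x) \<le> k / 2"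
      using t T by (intro bexI[of _ t]) (auto simp: a_def)
    have eq: "(2 * T - t) *\<^sub>R b = (y + (2 * T) *\<^sub>R b) - a - s *\<^sub>R v" by (simp add: a_def algebra_simps)
    have "2 * T - t = norm ((2 * T - t) *\<^sub>R b)" using b t T by simp
    also have "\<dots> \<le> norm (y + (2 * T) *\<^sub>R b) + norm a + norm (s *\<^sub>R v)"
      unfolding eq using norm_triangle_ineq4 by (meson add_right_mono order_trans)
    also have "\<dots> \<le> norm (y + (2 * T) *\<^sub>R b) + k / (6 * \<theta>) + L"
      using t norm_v norm_sublevel_le[OF t(3) k(1)] by (intro add_mono) (auto simp: a_def)
    finally have "4 * k / (\<delta> * \<theta>) \<le> norm (y + (2 * T) *\<^sub>R b)"
      using N2\<sigma> t k(3) by (simp add: T_def)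
    then have "F (y + (2 * T) *\<^sub>R b) - G x \<bullet> (y + (2 * T) *\<^sub>R b) - (F x - G x \<bullet> x) > k"
      using x \<delta> k by (intro far_outside_section[where B=B]) auto
    with in_half show "F (y + (2 * T) *\<^sub>R b) - G x \<bullet> (y + (2 * T) *\<^sub>R b) - (F x - G x \<bullet> x) > k \<and>
      (\<exists>s\<in>{0..2 * T}. F (y + s *\<^sub>R b) - G x \<bullet> (y + s *\<^sub>R b) - (F x - G x \<bullet> x) \<le> k / 2)" by blast
  qed (use b T k in auto)
  have Gx: "norm (G x) \<le> \<theta>"
    using x \<delta> \<theta>_pos norm_v by (simp add: near_slow_def abs_mult mult_le_cancel_right1)
  have "ennreal (k / 2 * real N2) * (of_nat N * emeasure lborel (shadow b k (k / 24)))
      \<le> ennreal (k / 2) * (of_nat N2 * emeasure lborel (Q k))"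
  proof -
    have "ennreal (k / 2 * real N2) = ennreal (k / 2) * of_nat N2"
      using k(3) by (subst ennreal_mult) (auto simp: ennreal_of_nat_eq_real_of_nat)
    then show ?thesis using 1 by (simp add: mult.assoc mult_left_mono)
  qed
  also have "\<dots> \<le> ennreal (k / 2) * emeasure lborel (Q T)" by (intro mult_left_mono 2) simp
  also note 3
  also have "ennreal (2 * T * (c + norm (G x))) * area x k
      \<le> ennreal (k / 2 * real N2 * (4 * (1 + \<kappa>) * (c + \<theta>))) * area x k"
  proof (intro mult_right_mono ennreal_leI)
    \<comment> \<open>\<open>T\<close> is bounded by a multiple of \<open>k * N2\<close>, so
      \<open>N2\<close> cancels and the final constant is independent of
      \<open>\<delta>\<close>.\<close>
    have "T \<le> k * real N2 * (1 + \<kappa>)"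
      using N2(1) k(3) by (simp add: T_def \<sigma>_def algebra_simps mult_le_cancel_left1)
    then have "2 * T * (c + norm (G x)) \<le> 2 * (k * real N2 * (1 + \<kappa>)) * (c + \<theta>)"
      using T Gx c_pos \<kappa>(2) k(3) by (intro mult_mono) auto
    then show "2 * T * (c + norm (G x)) \<le> k / 2 * real N2 * (4 * (1 + \<kappa>) * (c + \<theta>))"
      by (simp add: algebra_simps)
  qed simp
  also have "\<dots> = ennreal (k / 2 * real N2) * (ennreal (4 * (1 + \<kappa>) * (c + \<theta>)) * area x k)"
    using k(3) \<kappa>(2) c_pos \<theta>_pos by (subst ennreal_mult) (auto simp: mult.assoc)
  finally show ?thesis using k(3) N2(1) by (simp add: ennreal_mult_le_mult_iff)
qed


text \<open>Order of choices: \<open>N\<close> depends on \<open>M\<close> and \<open>b\<close>,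
  then \<open>\<delta>\<close> is small enough for \<open>N\<close> translates to fit, and the
  threshold for \<open>k\<close> comes last, as it depends on \<open>x\<close> and \<open>B\<close>.
  The parallel case is separate because \<open>1 - (v \<bullet> b)\<^sup>2\<close> vanishes
  there.\<close>

lemma eventually_area_ge:
  assumes b: "norm b = 1" and M: "M > 0"
  shows "\<forall>\<^sub>F \<delta> in at_right 0. \<forall>x B. near_slow \<delta> x B \<longrightarrow>
    (\<forall>\<^sub>F k in at_top. ennreal M * emeasure lborel (shadow b k (k / 24)) \<le> area x k)"
proof -
  have ev_\<delta>: "\<forall>\<^sub>F \<delta> in at_right 0. 0 < \<delta> \<and> \<delta> < 1 \<and> K \<le> 1 / (8 * \<delta> * \<theta>)" if "K > 0" for K
  proof -
    have "K \<le> 1 / (8 * \<delta> * \<theta>)" if "0 < \<delta>" "\<delta> < 1 / (8 * K * \<theta>)" for \<delta>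
      using that \<open>K > 0\<close> \<theta>_pos by (simp add: field_simps)
    then show ?thesis
      using \<open>K > 0\<close> \<theta>_pos eventually_at_right_real[of 0 "min 1 (1 / (8 * K * \<theta>))"]
      by (auto elim: eventually_mono)
  qed
  have ev_k: "\<forall>\<^sub>F k in at_top. k \<ge> 24 * B0 \<and> k \<ge> 8 * (G x \<bullet> x - F x) \<and> k > 0 \<and> k > B" for x B
    by (intro eventually_conj eventually_ge_at_top eventually_gt_at_top)
  show ?thesis
  proof (cases "b = v \<or> b = - v")
    case True
    obtain N :: nat where N: "M < real N" using reals_Archimedean2 by blast
    then have "real N * (1 / \<theta> + 2) > 0" using M \<theta>_pos by (intro mult_pos_pos add_pos_pos) auto
    from ev_\<delta>[OF this] show ?thesis
    proof eventually_elim
      case (elim \<delta>)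
      show ?case
      proof (intro allI impI)
        fix x B assume x: "near_slow \<delta> x B"
        show "\<forall>\<^sub>F k in at_top. ennreal M * emeasure lborel (shadow b k (k / 24)) \<le> area x k"
          using ev_k[of x B]
        proof eventually_elim
          case (elim k)
          have "ennreal M * emeasure lborel (shadow b k (k / 24)) \<le> of_nat N * emeasure lborel (shadow b k (k / 24))"
            using N by (intro mult_right_mono) (auto simp: ennreal_of_nat_eq_real_of_nat intro: ennreal_leI)
          also have "\<dots> \<le> area x k"
            using x True elim \<open>0 < \<delta> \<and> \<delta> < 1 \<and> _\<close> by (intro area_ge_parallel[where B=B and \<delta>=\<delta>]) auto
          finally show ?case .
        qed
      qed
    qed
  next
    case False
    have "(v \<bullet> b)\<^sup>2 < 1"
    proof -
      have "\<bar>v \<bullet> b\<bar> \<le> 1" using Cauchy_Schwarz_ineq2[of v b] norm_v b by simp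
      moreover have "\<bar>v \<bullet> b\<bar> \<noteq> 1"
      proof
        assume "\<bar>v \<bullet> b\<bar> = 1"
        then have "\<bar>v \<bullet> b\<bar> = norm v * norm b" using norm_v b by simp
        then show False using False norm_v b unfolding norm_cauchy_schwarz_abs_eq by auto
      qed
      ultimately show ?thesis by (simp add: abs_square_less_1)
    qed
    then have \<beta>: "1 - (v \<bullet> b)\<^sup>2 > 0" by simp
    \<comment> \<open>A unit shift along \<open>v\<close> changes the functional that ignores
      \<open>b\<close> only by \<open>1 - (v \<bullet> b)\<^sup>2\<close>; dividing by it restores
      the separation of the parallel case.\<close>
    define \<kappa> where "\<kappa> = (1 / \<theta> + 2) / (1 - (v \<bullet> b)\<^sup>2)"
    have \<kappa>: "\<kappa> * (1 - (v \<bullet> b)\<^sup>2) = 1 / \<theta> + 2" "\<kappa> > 0"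
      using \<beta> \<theta>_pos by (auto simp: \<kappa>_def intro!: divide_pos_pos add_pos_pos)
    define D where "D = 4 * (1 + \<kappa>) * (c + \<theta>)"
    have D: "D > 0" using \<kappa>(2) c_pos \<theta>_pos by (simp add: D_def)
    obtain N :: nat where N: "M * D < real N" using reals_Archimedean2 by blast
    have "M * D > 0" using M D by simp
    then have "real N * \<kappa> > 0" using N \<kappa>(2) by (intro mult_pos_pos) auto
    from ev_\<delta>[OF this] show ?thesis
    proof eventually_elim
      case (elim \<delta>)
      show ?case
      proof (intro allI impI)
        fix x B assume x: "near_slow \<delta> x B"
        show "\<forall>\<^sub>F k in at_top. ennreal M * emeasure lborel (shadow b k (k / 24)) \<le> area x k"
          using ev_k[of x B]
        proof eventually_elim
          case (elim k)
          have "ennreal D * (ennreal M * emeasure lborel (shadow b k (k / 24)))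
             \<le> of_nat N * emeasure lborel (shadow b k (k / 24))"
            using N M D unfolding mult.assoc[symmetric]
            by (intro mult_right_mono)
              (auto simp: ennreal_of_nat_eq_real_of_nat mult.commute simp flip: ennreal_mult intro: ennreal_leI)
          also have "\<dots> \<le> ennreal D * area x k"
            unfolding D_def using x b \<kappa> elim \<open>0 < \<delta> \<and> \<delta> < 1 \<and> _\<close> by (intro area_ge_transversal[where B=B and \<delta>=\<delta>]) auto
          finally show ?case using D by (simp add: ennreal_mult_le_mult_iff)
        qed
      qed
    qed
  qed
qed

text \<open>Links the level \<open>k\<close> of the upper bound at 0 with the level
  \<open>k / 24\<close> over which the cylinders stand. By convexity and \<open>F 0 = 0\<close>,
  dividing by 24 maps the larger shadow into the smaller one.\<close>

lemma shadow_scale: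
  assumes "k > 0"
  shows "emeasure lborel (shadow b k k) \<le> ennreal (24 ^ DIM('a)) * emeasure lborel (shadow b k (k / 24))"
proof -
  have sub: "shadow b k k \<subseteq> (*\<^sub>R) 24 ` shadow b k (k / 24)"
  proof
    fix y assume "y \<in> shadow b k k"
    then obtain t where t: "t \<in> {0..k}" "F (y + t *\<^sub>R b) \<le> k" unfolding shadow_def by blast
    have "F ((1/24) *\<^sub>R (y + t *\<^sub>R b)) \<le> (1/24) * F (y + t *\<^sub>R b)" by (intro F_scale_le) auto
    then have "F ((1/24) *\<^sub>R y + (t/24) *\<^sub>R b) \<le> k / 24" using t by (simp add: scaleR_add_right)
    then have "(1/24) *\<^sub>R y \<in> shadow b k (k / 24)"
      using t unfolding shadow_def by (intro CollectI bexI[of _ "t/24"]) auto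
    then show "y \<in> (*\<^sub>R) 24 ` shadow b k (k / 24)" by (intro image_eqI[of _ _ "(1/24) *\<^sub>R y"]) auto
  qed
  have "compact ((*\<^sub>R) 24 ` shadow b k (k / 24))" by (intro compact_scaling compact_shadow)
  then have "emeasure lborel (shadow b k k) \<le> emeasure lborel ((*\<^sub>R) 24 ` shadow b k (k / 24))"
    using sub by (intro emeasure_mono) (auto simp: borel_compact)
  also have "\<dots> = ennreal (24 ^ DIM('a)) * emeasure lborel (shadow b k (k / 24))"
    by (intro emeasure_lborel_scaleR) auto
  finally show ?thesis .
qed

lemma no_slow_direction:
  assumes near: "\<And>\<delta>. 0 < \<delta> \<Longrightarrow> \<delta> < 1 \<Longrightarrow> \<exists>x B. near_slow \<delta> x B"
  shows False
proof -
  \<comment> \<open>\<open>C\<close> collects the bound \<open>c * (1 + \<theta>)\<close> on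
    \<open>W x\<close> and the factors from \<open>area_zero_le\<close> and
    \<open>shadow_scale\<close>. \<open>M\<close> exceeds \<open>DIM('a) * C\<close> because the
    lower bounds for all basis vectors are summed.\<close>
  define C where "C = c * (1 + \<theta>) * (3 * c) * 24 ^ DIM('a)"
  define M where "M = real DIM('a) * C + 1"
  have C: "C > 0" using c_pos \<theta>_pos by (simp add: C_def)
  have M: "M > 0" using C by (simp add: M_def add_nonneg_pos)
  have "\<forall>\<^sub>F \<delta> in at_right 0. \<forall>b\<in>Basis. \<forall>x B. near_slow \<delta> x B \<longrightarrow>
    (\<forall>\<^sub>F k in at_top. ennreal M * emeasure lborel (shadow b k (k / 24)) \<le> area x k)"
    using M by (intro eventually_ball_finite ballI eventually_area_ge) auto
  moreover have "\<forall>\<^sub>F \<delta>::real in at_right 0. 0 < \<delta> \<and> \<delta> < 1"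
    using eventually_at_right_real[of 0 1] by simp
  ultimately have "\<forall>\<^sub>F \<delta> in at_right 0. (0 < \<delta> \<and> \<delta> < 1) \<and> (\<forall>b\<in>Basis. \<forall>x B. near_slow \<delta> x B \<longrightarrow>
    (\<forall>\<^sub>F k in at_top. ennreal M * emeasure lborel (shadow b k (k / 24)) \<le> area x k))"
    by eventually_elim auto
  then obtain \<delta> where \<delta>: "0 < \<delta>" "\<delta> < 1" and ge: "\<And>b x B. b \<in> Basis \<Longrightarrow> near_slow \<delta> x B \<Longrightarrow>
    (\<forall>\<^sub>F k in at_top. ennreal M * emeasure lborel (shadow b k (k / 24)) \<le> area x k)"
    using eventually_happens'[OF trivial_limit_at_right_real] by blast
  obtain x B where x: "near_slow \<delta> x B" using near[OF \<delta>] by blast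
  have "\<forall>\<^sub>F k in at_top. \<forall>b\<in>Basis. ennreal M * emeasure lborel (shadow b k (k / 24)) \<le> area x k"
    using ge x by (intro eventually_ball_finite) auto
  moreover have "\<forall>\<^sub>F k::real in at_top. k > 0" by (rule eventually_gt_at_top)
  ultimately have "\<forall>\<^sub>F k in at_top. k > 0 \<and> (\<forall>b\<in>Basis. ennreal M * emeasure lborel (shadow b k (k / 24)) \<le> area x k)"
    by eventually_elim auto
  then obtain k where k: "k > 0"
    and kge: "\<And>b. b \<in> Basis \<Longrightarrow> ennreal M * emeasure lborel (shadow b k (k / 24)) \<le> area x k"
    using eventually_happens'[OF trivial_limit_at_top_linorder] by blast
  define S where "S = (\<Sum>b\<in>(Basis::'a set). emeasure lborel (shadow b k (k / 24)))"
  have S_fin: "S < \<infinity>"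
    unfolding S_def using emeasure_compact_finite[OF compact_shadow] by (simp add: less_top)
  have S_pos: "S > 0"
  proof -
    obtain b :: 'a where b: "b \<in> Basis" using nonempty_Basis by blast
    have "0 < emeasure lborel {y. F y \<le> k / 24}" using k by (intro sublevel_emeasure_pos) auto
    also have "\<dots> \<le> emeasure lborel (shadow b k (k / 24))"
      using k by (intro emeasure_mono sublevel_subset_shadow) auto
    also have "\<dots> \<le> S" unfolding S_def using b by (intro member_le_sum) auto
    finally show ?thesis .
  qed
  have "norm (G x) \<le> \<theta>"
    using x \<delta> \<theta>_pos norm_v by (simp add: near_slow_def abs_mult mult_le_cancel_right1)
  then have "W x \<le> c * (1 + \<theta>)"
    using W_le_G[of x] c_pos by (smt (verit) mult_left_mono)
  have W0: "1 \<le> W 0" by (rule W_ge_1)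
  have "W x * \<eta> k \<le> (c * (1 + \<theta>)) * (W 0 * \<eta> k)"
    using \<open>W x \<le> c * (1 + \<theta>)\<close> W0 \<eta>_nonneg[OF k] c_pos \<theta>_pos
    by (intro mult_mono) (auto simp: mult_le_cancel_right1)
  then have "area x k \<le> ennreal (c * (1 + \<theta>)) * area 0 k"
    using k c_pos \<theta>_pos W0 \<eta>_nonneg[OF k] by (simp add: area ennreal_leI flip: ennreal_mult)
  also have "\<dots> \<le> ennreal (c * (1 + \<theta>)) * (ennreal (3 * c) * (\<Sum>b\<in>(Basis::'a set). emeasure lborel (shadow b k k)))"
    by (intro mult_left_mono area_zero_le k) simp
  also have "\<dots> \<le> ennreal (c * (1 + \<theta>)) * (ennreal (3 * c) *
      (\<Sum>b\<in>(Basis::'a set). ennreal (24 ^ DIM('a)) * emeasure lborel (shadow b k (k / 24))))"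
    using k by (intro mult_left_mono sum_mono shadow_scale) auto
  also have "\<dots> = ennreal C * S"
  proof -
    have "ennreal C = ennreal (c * (1 + \<theta>)) * (ennreal (3 * c) * ennreal (24 ^ DIM('a)))"
      unfolding C_def using c_pos \<theta>_pos by (simp add: mult.assoc flip: ennreal_mult)
    then show ?thesis unfolding S_def by (simp only: sum_distrib_left[symmetric] mult.assoc)
  qed
  finally have upper: "area x k \<le> ennreal C * S" .
  have "ennreal M * S = (\<Sum>b\<in>(Basis::'a set). ennreal M * emeasure lborel (shadow b k (k / 24)))"
    unfolding S_def by (rule sum_distrib_left)
  also have "\<dots> \<le> (\<Sum>b\<in>(Basis::'a set). ennreal C * S)"
    using kge upper by (intro sum_mono) (blast intro: order_trans)
  also have "\<dots> = ennreal (real DIM('a) * C) * S"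
    using C by (simp add: ennreal_mult ennreal_of_nat_eq_real_of_nat mult.assoc)
  finally have "S * ennreal M \<le> S * ennreal (real DIM('a) * C)" by (simp add: mult.commute)
  then have "ennreal M \<le> ennreal (real DIM('a) * C)"
    using S_pos S_fin by (subst (asm) ennreal_mult_le_mult_iff) auto
  then show False using C by (simp add: M_def)
qed

end

section \<open>The critical slope\<close>

context section_area
begin

lemma area_eq_inconsistent: False
proof (cases "\<forall>a. \<exists>b. \<forall>y. a * norm y - b \<le> F y")
  case True
  then show False by (intro not_superlinear) blast
next
  case False
  define \<Theta> where "\<Theta> = {a. \<exists>b. \<forall>y. a * norm y - b \<le> F y}"
  from False obtain a0 where a0: "a0 \<notin> \<Theta>" unfolding \<Theta>_def by blast
  have down: "a \<in> \<Theta>" if "a' \<in> \<Theta>" "a \<le> a'" for a a'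
  proof -
    obtain b where b: "\<And>y. a' * norm y - b \<le> F y" using \<open>a' \<in> \<Theta>\<close> unfolding \<Theta>_def by blast
    have "a * norm y - b \<le> F y" for y
      using b[of y] mult_right_mono[OF that(2), of "norm y"] by simp
    then show ?thesis unfolding \<Theta>_def by blast
  qed
  \<comment> \<open>\<open>\<Theta>\<close> is closed downwards, so any missing slope bounds it from
    above.\<close>
  have bdd: "bdd_above \<Theta>" using a0 down by (intro bdd_aboveI[of _ a0]) (meson linear)
  obtain a1 where a1: "a1 > 0" "\<And>y. a1 * norm y - 1 \<le> F y"
    using linear_growth[OF finite_sublevel] by blast
  then have a1\<Theta>: "a1 \<in> \<Theta>" unfolding \<Theta>_def by blast
  define \<theta> where "\<theta> = Sup \<Theta>"
  have \<theta>: "\<theta> > 0" using cSup_upper[OF a1\<Theta> bdd] a1(1) by (simp add: \<theta>_def)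
  have below: "\<exists>b. \<forall>y. a * norm y - b \<le> F y" if less: "a < \<theta>" for a
  proof -
    have "\<Theta> \<noteq> {}" using a1\<Theta> by blast
    then obtain a' where "a' \<in> \<Theta>" "a < a'"
      using less unfolding \<theta>_def by (metis less_cSupE)
    then have "a \<in> \<Theta>" using down by simp
    then show ?thesis by (simp add: \<Theta>_def)
  qed
  have above: "\<exists>y. F y < a * norm y - b" if "a > \<theta>" for a b
  proof -
    have "a \<notin> \<Theta>" using cSup_upper[OF _ bdd, of a] that unfolding \<theta>_def by linarith
    then show ?thesis by (auto simp: \<Theta>_def not_le)
  qed
  obtain v where v: "norm v = 1" "\<And>y s. s \<ge> 0 \<Longrightarrow> F (y + s *\<^sub>R v) \<le> F y + s * \<theta>"
    using slowest_direction[OF above] \<theta> by (metis less_imp_le)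
  obtain B0 where B0: "\<And>y. \<theta> / 2 * norm y - B0 \<le> F y" using below[of "\<theta> / 2"] \<theta> by auto
  interpret slow_direction F G W c \<eta> v \<theta> B0
    by unfold_locales (use v \<theta> B0 in auto)
  show False
  proof (rule no_slow_direction)
    fix \<delta> :: real assume \<delta>: "0 < \<delta>" "\<delta> < 1"
    define p where "p = ((1 - \<delta>) * \<theta>) *\<^sub>R v"
    \<comment> \<open>This slope lies below the supremum, hence is admissible. Tilting by
      \<open>(1 - \<delta>) * \<theta>\<close> along \<open>v\<close> leaves growth of slope
      \<open>\<delta> * \<theta> / 2\<close>, enough for the tilted minimum to exist.\<close>
    have "(1 - \<delta> / 2) * \<theta> < \<theta>" using \<delta> \<theta> by simp
    then obtain B where B: "\<And>y. (1 - \<delta> / 2) * \<theta> * norm y - B \<le> F y" using below by blast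
    have gr: "\<delta> * \<theta> / 2 * norm y - B \<le> F y - p \<bullet> y" for y
    proof -
      have "norm p = (1 - \<delta>) * \<theta>" using \<delta> \<theta> v(1) by (simp add: p_def)
      then have "p \<bullet> y \<le> (1 - \<delta>) * \<theta> * norm y" using norm_cauchy_schwarz[of p y] by simp
      then show ?thesis using B[of y] by (simp add: algebra_simps)
    qed
    obtain x where "G x = p" "\<And>y. F x - p \<bullet> x \<le> F y - p \<bullet> y"
      using slope_attained[OF _ gr] \<delta> \<theta> by (metis half_gt_zero mult_pos_pos)
    with gr have "near_slow \<delta> x B" by (simp add: near_slow_def p_def)
    then show "\<exists>x B. near_slow \<delta> x B" by blast
  qed
qed

end

section \<open>Smooth convex functions\<close>

text \<open>Jensen's inequality bounds the remainder of a convex function from above by its values on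
  the coordinate axes, and convexity bounds it from below by the reflected upper bound.\<close>
lemma convex_has_derivative_partials:
  fixes f :: "real ^ 'n \<Rightarrow> real"
  assumes conv: "convex_on UNIV f"
    and part: "\<And>i. ((\<lambda>t. f (x + t *\<^sub>R axis i 1)) has_real_derivative D $ i) (at 0)"
  shows "(f has_derivative (\<lambda>h. D \<bullet> h)) (at x)"
  unfolding has_derivative_at_alt
proof (intro conjI allI impI)
  show "bounded_linear (\<lambda>h. D \<bullet> h)" by (rule bounded_linear_inner_right)
  fix e :: real assume e: "e > 0"
  define n where "n = real CARD('n)"
  have n: "n \<ge> 1" by (simp add: n_def Suc_leI)
  define R where "R y = f (x + y) - f x - D \<bullet> y" for y
  have convR: "convex_on UNIV R"
  proof (rule convex_onI)
    fix t :: real and y z assume t: "0 < t" "t < 1"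
    have "f ((1 - t) *\<^sub>R (x + y) + t *\<^sub>R (x + z)) \<le> (1 - t) * f (x + y) + t * f (x + z)"
      using convex_onD[OF conv, of t "x + y" "x + z"] t by auto
    moreover have "(1 - t) *\<^sub>R (x + y) + t *\<^sub>R (x + z) = x + ((1 - t) *\<^sub>R y + t *\<^sub>R z)"
      by (simp add: algebra_simps)
    ultimately show "R ((1 - t) *\<^sub>R y + t *\<^sub>R z) \<le> (1 - t) * R y + t * R z"
      unfolding R_def by (simp add: algebra_simps inner_simps)
  qed simp
  have "\<exists>d>0. \<forall>t. \<bar>t\<bar> < d \<longrightarrow> R (t *\<^sub>R axis i 1) \<le> e / n * \<bar>t\<bar>" for i
  proof -
    have "e / n > 0" using e n by simp
    then obtain d where "d > 0"
      "\<forall>t. norm (t - 0) < d \<longrightarrow> norm (f (x + t *\<^sub>R axis i 1) - f (x + 0 *\<^sub>R axis i 1) - D $ i * (t - 0)) \<le> e / n * norm (t - 0)"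
      using part[of i] unfolding has_field_derivative_def has_derivative_at_alt by blast
    then show ?thesis
      by (intro exI[of _ d]) (auto simp: R_def inner_axis abs_le_iff mult.commute)
  qed
  then obtain d where d: "\<And>i. d i > 0" "\<And>i t. \<bar>t\<bar> < d i \<Longrightarrow> R (t *\<^sub>R axis i 1) \<le> e / n * \<bar>t\<bar>" by metis
  \<comment> \<open>The division by \<open>n\<close> is there because \<open>y\<close> is the
    average of axis points with coordinates \<open>n * y $ i\<close>, and these must stay within
    \<open>d i\<close>.\<close>
  define r where "r = Min (range d) / n"
  have r: "r > 0" using d(1) n by (simp add: r_def)
  have upper: "R y \<le> e * norm y" if y: "norm y < r" for y
  proof -
    have "y = (\<Sum>i\<in>UNIV. (1 / n) *\<^sub>R ((n * y $ i) *\<^sub>R axis i 1))"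
      using n basis_expansion[of y] by (simp add: scalar_mult_eq_scaleR)
    moreover have "R (\<Sum>i\<in>UNIV. (1 / n) *\<^sub>R ((n * y $ i) *\<^sub>R axis i 1)) \<le> (\<Sum>i\<in>UNIV. (1 / n) * R ((n * y $ i) *\<^sub>R axis i 1))"
      using n by (intro convex_on_sum[OF _ _ convR]) (auto simp: n_def)
    ultimately have "R y \<le> (\<Sum>i\<in>UNIV. (1 / n) * R ((n * y $ i) *\<^sub>R axis i 1))" by simp
    also have "\<dots> \<le> (\<Sum>i\<in>(UNIV::'n set). (1 / n) * (e * norm y))"
    proof (intro sum_mono mult_left_mono)
      fix i
      have "\<bar>n * y $ i\<bar> \<le> n * norm y" using n component_le_norm_cart[of y i] by (simp add: abs_mult)
      also have "n * norm y < n * r" using y n by simp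
      also have "n * r \<le> d i" using n by (simp add: r_def)
      finally have "R ((n * y $ i) *\<^sub>R axis i 1) \<le> e / n * \<bar>n * y $ i\<bar>" by (rule d(2))
      also have "\<dots> \<le> e * norm y" using n e component_le_norm_cart[of y i] by (simp add: abs_mult)
      finally show "R ((n * y $ i) *\<^sub>R axis i 1) \<le> e * norm y" .
    qed (use n in simp)
    also have "\<dots> = e * norm y" using n by (simp add: n_def)
    finally show ?thesis .
  qed
  show "\<exists>d>0. \<forall>y. norm (y - x) < d \<longrightarrow> norm (f y - f x - D \<bullet> (y - x)) \<le> e * norm (y - x)"
  proof (intro exI[of _ r] conjI allI impI r)
    fix y assume y: "norm (y - x) < r"
    define z where "z = y - x"
    have "R ((1 - 1/2) *\<^sub>R z + (1/2) *\<^sub>R (- z)) \<le> (1 - 1/2) * R z + 1/2 * R (- z)"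
      by (rule convex_onD[OF convR]) auto
    moreover have "R ((1 - 1/2) *\<^sub>R z + (1/2) *\<^sub>R (- z)) = 0" by (simp add: R_def)
    ultimately have "- R z \<le> R (- z)" by simp
    also have "\<dots> \<le> e * norm z" using upper[of "- z"] y by (simp add: z_def norm_minus_commute)
    finally show "norm (f y - f x - D \<bullet> (y - x)) \<le> e * norm (y - x)"
      using upper[of z] y by (simp add: z_def R_def abs_le_iff)
  qed
qed

lemma grad_eqI:
  assumes "(f has_derivative (\<lambda>h. D \<bullet> h)) (at x)"
  shows "grad f x = D"
  unfolding grad_def
proof (rule the_equality)
  show "E = D" if "(f has_derivative (\<lambda>h. E \<bullet> h)) (at x)" for E
  proof -
    have "(\<lambda>h. E \<bullet> h) = (\<lambda>h. D \<bullet> h)" by (rule has_derivative_unique[OF that assms])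
    then show ?thesis by (metis vector_eq_rdot)
  qed
qed (rule assms)

text \<open>The family in \<open>smooth_fun\<close> supplies continuous first partial derivatives;
  convexity turns them into a total derivative, which identifies \<open>grad f\<close>.\<close>

lemma smooth_convex_C1:
  assumes "smooth_fun f" "convex_on UNIV f"
  shows "convex_C1 f (grad f)"
proof -
  obtain S where S: "f \<in> S" "\<And>g. g \<in> S \<Longrightarrow> continuous_on UNIV g"
    "\<And>g i. g \<in> S \<Longrightarrow> \<exists>h\<in>S. \<forall>x. ((\<lambda>t. g (x + t *\<^sub>R axis i 1)) has_real_derivative h x) (at 0)"
    using assms(1) unfolding smooth_fun_def by blast
  obtain h where h: "\<And>i. h i \<in> S"
    "\<And>i x. ((\<lambda>t. f (x + t *\<^sub>R axis i 1)) has_real_derivative h i x) (at 0)"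
    using S(3)[OF S(1)] by metis
  have der: "(f has_derivative (\<lambda>v. (\<chi> i. h i x) \<bullet> v)) (at x)" for x
    using h(2) by (intro convex_has_derivative_partials[OF assms(2)]) simp
  have grad: "grad f = (\<lambda>x. \<chi> i. h i x)"
    using grad_eqI[OF der] by (intro ext)
  show ?thesis
    unfolding grad
  proof
    show "continuous_on UNIV (\<lambda>x. \<chi> i. h i x)"
      by (intro continuous_on_vec_lambda S(2) h(1))
  qed (use assms(2) der in auto)
qed

theorem theorem7:
  fixes f :: "real ^ 'n \<Rightarrow> real"
  assumes "smooth_fun f"
    and "convex_on UNIV f"
  shows "\<not> (\<exists>\<eta> :: real \<Rightarrow> real. (\<forall>k>0. \<eta> k \<ge> 0) \<and>
            (\<forall>x. \<forall>k>0. S_star f x k / ennreal (Wfun f x) = ennreal (\<eta> k)))"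
proof
  assume "\<exists>\<eta> :: real \<Rightarrow> real. (\<forall>k>0. \<eta> k \<ge> 0) \<and>
            (\<forall>x. \<forall>k>0. S_star f x k / ennreal (Wfun f x) = ennreal (\<eta> k))"
  then obtain \<eta> where \<eta>: "\<And>k. k > 0 \<Longrightarrow> \<eta> k \<ge> 0"
    "\<And>x k. k > 0 \<Longrightarrow> S_star f x k / ennreal (Wfun f x) = ennreal (\<eta> k)" by blast
  interpret f: convex_C1 f "grad f" using assms by (rule smooth_convex_C1)
  define p where "p = grad f 0"
  define F where "F y = f y - p \<bullet> y - f 0" for y
  define G where "G y = grad f y - p" for y
  \<comment> \<open>\<open>c\<close> absorbs the shift of the gradient by \<open>p\<close> in both
    comparisons with \<open>Wfun f\<close>.\<close>
  define c where "c = 1 + norm p"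
  interpret F: convex_C1 F G unfolding F_def G_def by (rule f.tilted)
  have W1: "1 \<le> Wfun f y" for y by (simp add: Wfun_def)
  have grad_le: "norm (grad f y) \<le> Wfun f y" for y
    unfolding Wfun_def by (rule real_le_rsqrt) simp
  have W_le: "Wfun f y \<le> 1 + norm (grad f y)" for y
    unfolding Wfun_def by (rule real_le_lsqrt) (auto simp: power2_eq_square algebra_simps)
  have S_star: "S_star f x k = ennreal (Wfun f x * \<eta> k)" if "k > 0" for x k
  proof -
    \<comment> \<open>\<open>Wfun f x\<close> is finite and nonzero, so the division in
      \<open>ennreal\<close> can be undone.\<close>
    have "ennreal (Wfun f x) \<noteq> 0" using W1[of x] by (simp add: ennreal_eq_0_iff)
    then have "S_star f x k = S_star f x k / ennreal (Wfun f x) * ennreal (Wfun f x)"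
      by (simp add: ennreal_divide_times ennreal_mult_divide_eq)
    then show ?thesis using \<eta>[OF that] W1[of x] by (simp add: ennreal_mult mult.commute)
  qed
  \<comment> \<open>Subtracting an affine function leaves the slab unchanged, and the lower
    inequality holds everywhere because the graph lies above its tangent plane.\<close>
  have slab: "slab_region f x k = {y. F y \<le> F x + G x \<bullet> (y - x) + k}" for x k
    using f.tangent_le by (auto simp: slab_region_def F_def G_def inner_simps algebra_simps)
  interpret section_area F G "Wfun f" c \<eta>
  proof unfold_locales
    show "0 \<le> F y" for y using f.tangent_le[of 0 y] by (simp add: F_def p_def)
    show "F 0 = 0" by (simp add: F_def)
    show "continuous_on UNIV (Wfun f)"
      unfolding Wfun_def by (intro continuous_intros f.continuous_G)
    show "1 \<le> Wfun f y" for y by (rule W1)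
    show "norm (G y) \<le> c * Wfun f y" for y
    proof -
      have "norm (G y) \<le> norm (grad f y) + norm p" unfolding G_def by (rule norm_triangle_ineq4)
      also have "\<dots> \<le> Wfun f y + norm p * Wfun f y"
        using grad_le[of y] W1[of y] by (intro add_mono) (auto simp: mult_le_cancel_left1)
      finally show ?thesis by (simp add: c_def distrib_right)
    qed
    show "Wfun f y \<le> c * (1 + norm (G y))" for y
    proof -
      have "norm (grad f y) \<le> norm (G y) + norm p"
        using norm_triangle_ineq[of "G y" p] by (simp add: G_def)
      moreover have "0 \<le> norm p * norm (G y)" by simp
      moreover have "c * (1 + norm (G y)) = 1 + norm p + norm (G y) + norm p * norm (G y)"
        by (simp add: c_def algebra_simps)
      ultimately show ?thesis using W_le[of y] by linarith
    qed
    show "0 \<le> \<eta> k" if "k > 0" for k using \<eta>(1) that .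
    show "(\<integral>\<^sup>+ y. ennreal (Wfun f y) * indicator {y. F y \<le> F x + G x \<bullet> (y - x) + k} y \<partial>lborel) = ennreal (Wfun f x * \<eta> k)"
      if "k > 0" for x k
      using S_star[OF that, of x] unfolding S_star_def slab .
  qed
  show False by (rule area_eq_inconsistent)
qed

end
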